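(* Let $\mathcal{Z}$ be an arc diagram. Suppose $\textstyle\int:\bigoplus_{(h,s,t)\in\mathbf{w}}\mathcal{A}(h,s,t)\to\bigoplus_{(h,s,t)\in\mathbf{w}}\mathcal{A}(h,s,t)$ is a diagrammatically simple $\mathbb{Z}_2$-module homomorphism which preserves H-data, has pure Maslov degree, and satisfies $$\textstyle\int\partial+\partial\int=1.$$ Then $\int$ is the creation operator $A^*_{\mathcal{C}}$ of a creation choice function $\mathcal{C}$.
   Context: All algebra is over $\mathbb{Z}_2$. An arc diagram $\mathcal{Z}=(\mathbf{Z},\mathbf{a},r)$ consists of oriented intervals $\mathbf{Z}=\{Z_1,\dots,Z_l\}$, distinct points $\mathbf{a}=(a_1,\dots,a_{2k})$ (places) in the interiors of the intervals, ordered along them, and a 2-to-1 map $r:\mathbf{a}\to\{1,\dots,k\}$ such that oriented surgery on $\mathbf{Z}$ at all $0$-spheres $r^{-1}(i)$ yields a 1-manifold with no circle components. The fibres $P=\{p,q\}$ of $r$ are the matched pairs, identified with $1,\dots,k$. Let $-\infty_i,+\infty_i$ be the start and end of $Z_i$ and $\mathbf{a}_{\pm\infty}=\mathbf{a}\cup\{\pm\infty_i\}$, partially ordered along the intervals; the places cut the intervals into steps. A strand diagram is a triple $(S,T,\phi)$ with $S,T\subseteq\mathbf{a}_{\pm\infty}$ and $\phi:S\to T$ a bijection with $\phi(x)\ge x$; it is drawn as strands in $[0,1]\times\mathbf{Z}$ from $\{0\}\times S$ to $\{1\}\times T$, meeting efficiently; crossings are inversions ($x<y$ with $\phi(x)>\phi(y)$),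 counted by $\mathrm{inv}$. The product of $(S,T,\phi)$ and $(U,V,\psi)$ is $(S,V,\psi\phi)$ if $T=U$ and $\mathrm{inv}(\psi\phi)=\mathrm{inv}(\phi)+\mathrm{inv}(\psi)$, and $0$ otherwise; $\partial$ is the sum of all resolutions of one crossing which lower the number of crossings by exactly $1$. $I(S)$ is the identity diagram on $S$. For a set $s$ of matched pairs let $I(s)=\sum_S I(S)$, over all $S\subseteq \mathbf{a}_{\pm\infty}$ consisting of exactly one place of each pair in $s$, no other places, and any subset of $\{\pm\infty_i\}$. For $\mu=(S,T,\phi)$ without horizontal strands (fixed points) let $a(\mu)=\sum_U(S\cup U,T\cup U,\phi_U)$ over $U\subseteq\mathbf{a}_{\pm\infty}\setminus(S\cup T)$, $\phi_U$ extending $\phi$ by the identity. A diagram from $s$ to $t$ is a nonzero element $I(s)a(\mu)I(t)$; it is drawn as one picture with dotted horizontal strands at both places $p,q$ of every matched pair carrying a horizontal strand. The (augmented) strand algebra $\mathcal{A}=\mathcal{A}(\mathcal{Z})$ is the DGA with basis the diagrams. H-data is a triple $(h,s,t)$ with $h\in H_1(\mathbf{Z},\mathbf{a}_{\pm\infty})$ and $s,t$ sets of matched pairs. A diagram from $s$ to $t$ has H-grading $h=\sum_x[x,\phi(x)]$ and H-data $(h,s,t)$; $\mathcal{A}(h,s,t)$ is the span of diagrams with this H-data (a subcomplex). The Maslov grading is $\iota(D)=\mathrm{inv}(\mu)-m(h,S)$ for any term $\mu=(S,T,\phi)$ of $D$, where $m(h,S)$ is the sum over places $a\in S\cap\mathbf{a}$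 of the average multiplicity of $h$ on the two steps at $a$. $h$ (and any H-data or diagram with H-grading $h$) is viable if $h$ has multiplicity $0$ or $1$ on every step. In a viable diagram every crossing involves a horizontal strand, hence lies at a matched pair. A viable diagram is twisted if it has no crossings and is zero in the homology of $\mathcal{A}$. Viable H-data is twisted if some twisted diagram has that H-data; $\mathbf{w}$ is the set of twisted H-data. A matched pair $P=\{p,q\}$ is 11 (all-on) once occupied at $p$ by $(h,s,t)$ if $P\in s$, $P\in t$, and $h$ covers both steps adjacent to $p$ and neither step adjacent to $q$; every twisted $(h,s,t)$ has such a pair. A creation choice function $\mathcal{C}$ assigns to each $(h,s,t)\in\mathbf{w}$ one of its 11 once occupied pairs $\mathcal{C}(h,s,t)$. The creation operator $A^*_{\mathcal{C}}:\bigoplus_{\mathbf{w}}\mathcal{A}(h,s,t)\to\bigoplus_{\mathbf{w}}\mathcal{A}(h,s,t)$ is the linear map given on a diagram $D\in\mathcal{A}(h,s,t)$ as follows, with $P=\{p,q\}=\mathcal{C}(h,s,t)$ once occupied at $p$: if $D$ has a crossing at $P$, $A^*_{\mathcal{C}}D=0$; otherwise one strand of $D$ ends at $p$ and another begins at $p$, and $A^*_{\mathcal{C}}D$ is obtained by joining these into a single strand running past $p$ and adding dotted horizontal strands at $p$ and $q$. A linear map is diagrammatically simple if it sends each diagram to zero or to a single diagram. *)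

theory Defs
  imports Complex_Main "HOL-Library.Poly_Mapping" "HOL-Library.Z2"
begin

section \<open>Arc diagrams\<close>

text \<open>
  The intervals are numbered \<open>1, \<dots>, l\<close>. The pair \<open>(i, j)\<close> denotes the \<open>j\<close>-th place along the
  \<open>i\<close>-th interval, where \<open>1 \<le> j \<le> n i\<close>; moreover \<open>(i, 0)\<close> is the start \<open>-\<infinity>\<close> and
  \<open>(i, n i + 1)\<close> is the end \<open>+\<infinity>\<close> of that interval.
  A step is denoted by its initial point: \<open>(i, j)\<close> with \<open>0 \<le> j \<le> n i\<close> stands for the step from
  \<open>(i, j)\<close> to \<open>(i, j + 1)\<close>.
\<close>

type_synonym point = "nat \<times> nat"
type_synonym step = "nat \<times> nat"

record arc_diagram =
  num_intervals :: nat
  num_places :: "nat \<Rightarrow> nat"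
  num_pairs :: nat
  pair_of :: "point \<Rightarrow> nat"

definition places :: "arc_diagram \<Rightarrow> point set" where
  "places Z = {(i, j). i \<in> {1..num_intervals Z} \<and> j \<in> {1..num_places Z i}}"

definition points :: "arc_diagram \<Rightarrow> point set" where
  "points Z = {(i, j). i \<in> {1..num_intervals Z} \<and> j \<in> {0..num_places Z i + 1}}"

definition steps :: "arc_diagram \<Rightarrow> step set" where
  "steps Z = {(i, j). i \<in> {1..num_intervals Z} \<and> j \<in> {0..num_places Z i}}"

definition point_le :: "point \<Rightarrow> point \<Rightarrow> bool" where
  "point_le x y \<longleftrightarrow> fst x = fst y \<and> snd x \<le> snd y"

definition point_less :: "point \<Rightarrow> point \<Rightarrow> bool" where
  "point_less x y \<longleftrightarrow> fst x = fst y \<and> snd x < snd y"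

definition step_before :: "point \<Rightarrow> step" where
  "step_before p = (fst p, snd p - 1)"

definition step_after :: "point \<Rightarrow> step" where
  "step_after p = p"

definition matched_pairs :: "arc_diagram \<Rightarrow> nat set" where
  "matched_pairs Z = {1..num_pairs Z}"

definition pair_places :: "arc_diagram \<Rightarrow> nat \<Rightarrow> point set" where
  "pair_places Z P = {x \<in> places Z. pair_of Z x = P}"

text \<open>
  Oriented surgery at a matched pair \<open>{p, q}\<close> joins the step ending at \<open>p\<close> to the step beginning
  at \<open>q\<close>, and the step ending at \<open>q\<close> to the step beginning at \<open>p\<close>. The following is the resulting
  successor relation on steps; the surgered manifold has a circle component if and only if this
  relation has a cycle.
\<close>

definition surgery_succ :: "arc_diagram \<Rightarrow> (step \<times> step) set" where
  "surgery_succ Z = {(step_before p, step_after q) | p q.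
     p \<in> places Z \<and> q \<in> places Z \<and> p \<noteq> q \<and> pair_of Z p = pair_of Z q}"

definition is_arc_diagram :: "arc_diagram \<Rightarrow> bool" where
  "is_arc_diagram Z \<longleftrightarrow>
     (\<forall>x \<in> places Z. pair_of Z x \<in> matched_pairs Z) \<and>
     (\<forall>P \<in> matched_pairs Z. card (pair_places Z P) = 2) \<and>
     acyclic (surgery_succ Z)"


section \<open>Strand diagrams\<close>

text \<open>
  A strand diagram \<open>(S, T, \<phi>)\<close> is encoded as the graph \<open>{(x, \<phi> x) | x \<in> S}\<close> of \<open>\<phi>\<close>, so that \<open>S\<close>
  and \<open>T\<close> are its domain and range.
\<close>

type_synonym strands = "(point \<times> point) set"

definition strand_diagram :: "arc_diagram \<Rightarrow> strands \<Rightarrow> bool" where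
  "strand_diagram Z \<mu> \<longleftrightarrow>
     \<mu> \<subseteq> points Z \<times> points Z \<and> inj_on fst \<mu> \<and> inj_on snd \<mu> \<and>
     (\<forall>(x, y) \<in> \<mu>. point_le x y)"

definition crossings :: "strands \<Rightarrow> ((point \<times> point) \<times> (point \<times> point)) set" where
  "crossings \<mu> = {(\<sigma>, \<tau>). \<sigma> \<in> \<mu> \<and> \<tau> \<in> \<mu> \<and>
     point_less (fst \<sigma>) (fst \<tau>) \<and> point_less (snd \<tau>) (snd \<sigma>)}"

definition inv_count :: "strands \<Rightarrow> nat" where
  "inv_count \<mu> = card (crossings \<mu>)"

definition resolve :: "(point \<times> point) \<times> (point \<times> point) \<Rightarrow> strands \<Rightarrow> strands" where
  "resolve c \<mu> = (case c of (\<sigma>, \<tau>) \<Rightarrow>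
     (\<mu> - {\<sigma>, \<tau>}) \<union> {(fst \<sigma>, snd \<tau>), (fst \<tau>, snd \<sigma>)})"

text \<open>Formal sums of strand diagrams over the two-element field.\<close>

type_synonym chain = "strands \<Rightarrow>\<^sub>0 bit"

definition scale_chain :: "bit \<Rightarrow> chain \<Rightarrow> chain" where
  "scale_chain c x = Poly_Mapping.map ((*) c) x"

lemma lookup_scale_chain:
  "Poly_Mapping.lookup (scale_chain c x) \<mu> = c * Poly_Mapping.lookup x \<mu>"
  unfolding scale_chain_def map.rep_eq when_def by (metis mult_zero_right)

global_interpretation chain: vector_space scale_chain
  by unfold_locales
    (simp_all only: poly_mapping_eq_iff fun_eq_iff lookup_scale_chain lookup_add
      distrib_left distrib_right mult.assoc mult_1_left simp_thms)

definition basic :: "strands \<Rightarrow> chain" where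
  "basic \<mu> = Poly_Mapping.single \<mu> 1"

definition strand_mult :: "strands \<Rightarrow> strands \<Rightarrow> chain" where
  "strand_mult \<mu> \<nu> =
     (if Range \<mu> = Domain \<nu> \<and> inv_count (\<mu> O \<nu>) = inv_count \<mu> + inv_count \<nu>
      then basic (\<mu> O \<nu>) else 0)"

definition chain_mult :: "chain \<Rightarrow> chain \<Rightarrow> chain" (infixl "\<odot>" 70) where
  "x \<odot> y = (\<Sum>\<mu> \<in> Poly_Mapping.keys x. \<Sum>\<nu> \<in> Poly_Mapping.keys y. strand_mult \<mu> \<nu>)"

definition boundary_strands :: "strands \<Rightarrow> chain" where
  "boundary_strands \<mu> =
     (\<Sum>c | c \<in> crossings \<mu> \<and> inv_count (resolve c \<mu>) + 1 = inv_count \<mu>. basic (resolve c \<mu>))"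

definition boundary :: "chain \<Rightarrow> chain" where
  "boundary x = (\<Sum>\<mu> \<in> Poly_Mapping.keys x. boundary_strands \<mu>)"


section \<open>Diagrams and the strand algebra\<close>

definition sections :: "arc_diagram \<Rightarrow> nat set \<Rightarrow> point set set" where
  "sections Z s = {S. S \<subseteq> points Z \<and>
     (\<forall>P \<in> s. card (S \<inter> pair_places Z P) = 1) \<and>
     (\<forall>x \<in> S \<inter> places Z. pair_of Z x \<in> s)}"

definition idem :: "arc_diagram \<Rightarrow> nat set \<Rightarrow> chain" where
  "idem Z s = (\<Sum>S \<in> sections Z s. basic (Id_on S))"

definition no_horizontal :: "strands \<Rightarrow> bool" where
  "no_horizontal \<mu> \<longleftrightarrow> \<mu> \<inter> Id = {}"

definition add_horizontals :: "arc_diagram \<Rightarrow> strands \<Rightarrow> chain" where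
  "add_horizontals Z \<mu> =
     (\<Sum>U \<in> Pow (points Z - (Domain \<mu> \<union> Range \<mu>)). basic (\<mu> \<union> Id_on U))"

definition diagram :: "arc_diagram \<Rightarrow> nat set \<Rightarrow> strands \<Rightarrow> nat set \<Rightarrow> chain" where
  "diagram Z s \<mu> t = idem Z s \<odot> add_horizontals Z \<mu> \<odot> idem Z t"

text \<open>
  The relative homology group of the intervals modulo all points is the free abelian group on the
  steps. Its elements are represented by their multiplicities on the steps.
\<close>

type_synonym homology_class = "step \<Rightarrow>\<^sub>0 int"
type_synonym hdata = "homology_class \<times> nat set \<times> nat set"

definition segment_class :: "point \<Rightarrow> point \<Rightarrow> homology_class" where
  "segment_class x y = (\<Sum>j \<in> {snd x..<snd y}. Poly_Mapping.single (fst x, j) 1)"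

definition hclass :: "strands \<Rightarrow> homology_class" where
  "hclass \<mu> = (\<Sum>(x, y) \<in> \<mu>. segment_class x y)"

definition is_hdata :: "arc_diagram \<Rightarrow> hdata \<Rightarrow> bool" where
  "is_hdata Z H \<longleftrightarrow> (case H of (h, s, t) \<Rightarrow>
     Poly_Mapping.keys h \<subseteq> steps Z \<and> s \<subseteq> matched_pairs Z \<and> t \<subseteq> matched_pairs Z)"

definition diagrams :: "arc_diagram \<Rightarrow> hdata \<Rightarrow> chain set" where
  "diagrams Z H = {D. D \<noteq> 0 \<and> is_hdata Z H \<and> (case H of (h, s, t) \<Rightarrow>
     \<exists>\<mu>. strand_diagram Z \<mu> \<and> no_horizontal \<mu> \<and> D = diagram Z s \<mu> t \<and> h = hclass \<mu>)}"

definition all_diagrams :: "arc_diagram \<Rightarrow> chain set" where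
  "all_diagrams Z = (\<Union>H. diagrams Z H)"

definition hdata_of :: "arc_diagram \<Rightarrow> chain \<Rightarrow> hdata" where
  "hdata_of Z D = (THE H. D \<in> diagrams Z H)"

definition strand_algebra :: "arc_diagram \<Rightarrow> chain set" where
  "strand_algebra Z = chain.span (all_diagrams Z)"

definition hdata_summand :: "arc_diagram \<Rightarrow> hdata \<Rightarrow> chain set" where
  "hdata_summand Z H = chain.span (diagrams Z H)"


section \<open>Maslov grading\<close>

definition local_mult :: "homology_class \<Rightarrow> point set \<Rightarrow> rat" where
  "local_mult h A =
     (\<Sum>a \<in> A.
       of_int (Poly_Mapping.lookup h (step_before a) + Poly_Mapping.lookup h (step_after a)) / 2)"

text \<open>The value does not depend on the term \<open>\<mu>\<close> of the diagram that is selected.\<close>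

definition maslov :: "arc_diagram \<Rightarrow> chain \<Rightarrow> rat" where
  "maslov Z D = (let \<mu> = (SOME \<mu>. \<mu> \<in> Poly_Mapping.keys D)
     in of_nat (inv_count \<mu>) - local_mult (hclass \<mu>) (Domain \<mu> \<inter> places Z))"


section \<open>Twisted H-data\<close>

definition viable :: "arc_diagram \<Rightarrow> homology_class \<Rightarrow> bool" where
  "viable Z h \<longleftrightarrow> (\<forall>e \<in> steps Z. Poly_Mapping.lookup h e \<in> {0, 1})"

definition crossingless :: "chain \<Rightarrow> bool" where
  "crossingless D \<longleftrightarrow> (\<forall>\<nu> \<in> Poly_Mapping.keys D. crossings \<nu> = {})"

definition zero_in_homology :: "arc_diagram \<Rightarrow> chain \<Rightarrow> bool" where
  "zero_in_homology Z x \<longleftrightarrow> boundary x = 0 \<and> x \<in> boundary ` strand_algebra Z"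

definition twisted_hdata :: "arc_diagram \<Rightarrow> hdata set" where
  "twisted_hdata Z = {H. viable Z (fst H) \<and>
     (\<exists>D \<in> diagrams Z H. crossingless D \<and> zero_in_homology Z D)}"

definition diagrams_twisted_hdata :: "arc_diagram \<Rightarrow> chain set" where
  "diagrams_twisted_hdata Z = (\<Union>H \<in> twisted_hdata Z. diagrams Z H)"

definition twisted_sum :: "arc_diagram \<Rightarrow> chain set" where
  "twisted_sum Z = chain.span (\<Union>H \<in> twisted_hdata Z. hdata_summand Z H)"


section \<open>Creation operators\<close>

definition once_occupied_11_at :: "arc_diagram \<Rightarrow> hdata \<Rightarrow> nat \<Rightarrow> point \<Rightarrow> bool" where
  "once_occupied_11_at Z H P p \<longleftrightarrow> (case H of (h, s, t) \<Rightarrow>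
     P \<in> s \<and> P \<in> t \<and>
     (\<exists>q. pair_places Z P = {p, q} \<and> p \<noteq> q \<and>
        Poly_Mapping.lookup h (step_before p) \<noteq> 0 \<and> Poly_Mapping.lookup h (step_after p) \<noteq> 0 \<and>
        Poly_Mapping.lookup h (step_before q) = 0 \<and> Poly_Mapping.lookup h (step_after q) = 0))"

definition creation_choice :: "arc_diagram \<Rightarrow> (hdata \<Rightarrow> nat) \<Rightarrow> bool" where
  "creation_choice Z C \<longleftrightarrow>
     (\<forall>H \<in> twisted_hdata Z. C H \<in> matched_pairs Z \<and> (\<exists>p. once_occupied_11_at Z H (C H) p))"

text \<open>
  A crossing lies at the matched pair \<open>P\<close> if it involves a horizontal strand at a place of \<open>P\<close>.
\<close>

definition crossing_at :: "arc_diagram \<Rightarrow> nat \<Rightarrow> chain \<Rightarrow> bool" where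
  "crossing_at Z P D \<longleftrightarrow> (\<exists>\<nu> \<in> Poly_Mapping.keys D. \<exists>(\<sigma>, \<tau>) \<in> crossings \<nu>. \<exists>x \<in> pair_places Z P.
     \<sigma> = (x, x) \<or> \<tau> = (x, x))"

definition moving_strands :: "chain \<Rightarrow> strands" where
  "moving_strands D = \<Union> (Poly_Mapping.keys D) - Id"

definition join_at :: "point \<Rightarrow> strands \<Rightarrow> strands" where
  "join_at p \<mu> = {(x, y) \<in> \<mu>. x \<noteq> p \<and> y \<noteq> p} \<union> {(x, y). (x, p) \<in> \<mu> \<and> (p, y) \<in> \<mu>}"

text \<open>
  After joining at \<open>p\<close>, no moving strand begins or ends at a place of \<open>P\<close>, while \<open>P\<close> still belongs
  to \<open>s\<close> and \<open>t\<close>; hence \<open>diagram Z s _ t\<close> supplies the dotted horizontal strands at \<open>p\<close> and \<open>q\<close>.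
\<close>

definition create_diagram :: "arc_diagram \<Rightarrow> (hdata \<Rightarrow> nat) \<Rightarrow> chain \<Rightarrow> chain" where
  "create_diagram Z C D =
     (let H = hdata_of Z D; P = C H; p = (THE p. once_occupied_11_at Z H P p)
      in if crossing_at Z P D then 0
         else diagram Z (fst (snd H)) (join_at p (moving_strands D)) (snd (snd H)))"

definition creation_operator :: "arc_diagram \<Rightarrow> (hdata \<Rightarrow> nat) \<Rightarrow> chain \<Rightarrow> chain" where
  "creation_operator Z C x =
     (\<Sum>D | chain.representation (diagrams_twisted_hdata Z) x D \<noteq> 0.
        scale_chain (chain.representation (diagrams_twisted_hdata Z) x D)
          (create_diagram Z C D))"


section \<open>Properties of operators on the twisted summands\<close>

definition linear_on_subspace :: "chain set \<Rightarrow> (chain \<Rightarrow> chain) \<Rightarrow> bool" where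
  "linear_on_subspace V f \<longleftrightarrow>
     (\<forall>x \<in> V. \<forall>y \<in> V. f (x + y) = f x + f y) \<and>
     (\<forall>c. \<forall>x \<in> V. f (scale_chain c x) = scale_chain c (f x))"

definition diagrammatically_simple :: "arc_diagram \<Rightarrow> (chain \<Rightarrow> chain) \<Rightarrow> bool" where
  "diagrammatically_simple Z f \<longleftrightarrow>
     (\<forall>D \<in> diagrams_twisted_hdata Z. f D = 0 \<or> f D \<in> all_diagrams Z)"

definition preserves_hdata :: "arc_diagram \<Rightarrow> (chain \<Rightarrow> chain) \<Rightarrow> bool" where
  "preserves_hdata Z f \<longleftrightarrow> (\<forall>H \<in> twisted_hdata Z. f ` hdata_summand Z H \<subseteq> hdata_summand Z H)"

definition pure_maslov_degree :: "arc_diagram \<Rightarrow> (chain \<Rightarrow> chain) \<Rightarrow> bool" where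
  "pure_maslov_degree Z f \<longleftrightarrow> (\<exists>d. \<forall>m.
     f ` chain.span {D \<in> diagrams_twisted_hdata Z. maslov Z D = m}
       \<subseteq> chain.span {D \<in> diagrams_twisted_hdata Z. maslov Z D = m + d})"

end

theory Submission
  imports Defs
begin

text \<open>
  Fix twisted H-data \<open>(h, s, t)\<close>. A diagram with this H-data is determined by the set \<open>B\<close> of places
  at which one of its strands ends and another begins. The sets \<open>B\<close> that occur are the partial
  transversals of a set \<open>M\<close> of places, partitioned by matched pairs; the boundary adds one element
  to \<open>B\<close> in all possible ways, and the Maslov grading is a constant minus \<open>|B|\<close>. So \<open>f\<close> becomes a
  contraction of this cochain complex that sends each basis element to a basis element or to zero.
  If \<open>B\<close> is a maximal partial transversal, then \<open>f B\<close> has coboundary \<open>B\<close>, which forces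
  \<open>f B = B - {p}\<close> for a place \<open>p\<close> that is the only element of \<open>M\<close> in its pair, that is, for an 11 once
  occupied pair. Two maximal \<open>B\<close> that differ in one element have the same \<open>p\<close>, by the homotopy
  formula at their intersection, and descending induction on \<open>|B|\<close> shows that \<open>f\<close> removes this \<open>p\<close>
  from every \<open>B\<close>, which is the creation operator at the pair of \<open>p\<close>.
\<close>

section \<open>Contractions of complexes of partial transversals\<close>

text \<open>A place with \<open>h\<close> on both adjacent steps is either run past by a strand or a
  breakpoint, and the support of \<open>h\<close> together with the breakpoints determines all
  moving strands; this is why the sets \<open>B\<close> are the right coordinates. The partial
  transversals form the join of finite discrete sets, one for each class of \<open>M\<close>. Its
  augmented cochain complex is acyclic exactly when some class is a single point \<open>p\<close>,
  and then removal of the cone point \<open>p\<close> is a contraction. What has to be shown is that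
  simplicity leaves no other contraction. For neighbouring maximal sets with intersection
  \<open>F\<close>, the homotopy formula makes the image of \<open>F\<close> a single set
  \<open>G\<close>, whose coboundary must account for the images of all maximal sets above
  \<open>F\<close> at once. The degree hypothesis does its work for \<open>B\<close> not containing
  \<open>p\<close>. There the formula only says that the image of \<open>B\<close> has zero
  coboundary, so it is zero or maximal; as the maximal sets fix the degree to one, a nonzero image
  would have fewer elements than \<open>B\<close>, which a maximal set cannot have.\<close>

lemma sum_of_bool_unique:
  assumes "finite A" "a \<in> A" "Q a" "\<And>x. x \<in> A \<Longrightarrow> Q x \<Longrightarrow> x = a"
  shows "(\<Sum>x\<in>A. of_bool (Q x)) = (1 :: 'b :: comm_semiring_1)"
proof -
  have "(\<Sum>x\<in>A. of_bool (Q x)) = (\<Sum>x\<in>A. if x = a then 1 else (0 :: 'b))"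
  proof (rule sum.cong)
    show "of_bool (Q x) = (if x = a then 1 else (0 :: 'b))" if "x \<in> A" for x
    proof (cases "x = a")
      case True
      with \<open>Q a\<close> show ?thesis by simp
    next
      case False
      with assms(4)[OF that] have "\<not> Q x" by blast
      with False show ?thesis by simp
    qed
  qed simp
  then show ?thesis using assms(1,2) by simp
qed

lemma sum_of_bool_none:
  assumes "\<And>x. x \<in> A \<Longrightarrow> \<not> Q x"
  shows "(\<Sum>x\<in>A. of_bool (Q x)) = (0 :: 'b :: comm_semiring_1)"
  using assms by (intro sum.neutral) auto

locale partial_transversals =
  fixes M :: "'p set" and cls :: "'p \<Rightarrow> 'b"
  assumes finite_M: "finite M"
begin

definition indep :: "'p set \<Rightarrow> bool" where
  "indep B \<longleftrightarrow> B \<subseteq> M \<and> inj_on cls B"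

text \<open>For independent \<open>B\<close> these are the elements that can be added to
  \<open>B\<close>. They index the coboundary of \<open>B\<close>, and \<open>ext B = {}\<close>
  means that \<open>B\<close> is maximal (a facet).\<close>

definition ext :: "'p set \<Rightarrow> 'p set" where
  "ext B = {p \<in> M. cls p \<notin> cls ` B}"

text \<open>Such a \<open>p\<close> is a cone point: it can be added to every independent set that
  does not contain it.\<close>

definition isolated :: "'p \<Rightarrow> bool" where
  "isolated p \<longleftrightarrow> p \<in> M \<and> (\<forall>q \<in> M. cls q = cls p \<longrightarrow> q = p)"

lemma finite_ext: "finite (ext B)"
  using finite_M unfolding ext_def by auto

lemma finite_indep: "indep B \<Longrightarrow> finite B"
  using finite_M finite_subset unfolding indep_def by auto

lemma indep_insert: "indep B \<Longrightarrow> p \<in> ext B \<Longrightarrow> indep (insert p B)"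
  unfolding indep_def ext_def by auto

lemma indep_remove: "indep B \<Longrightarrow> indep (B - {p})"
  unfolding indep_def by (auto intro: inj_on_subset)

lemma ext_notin: "p \<in> ext B \<Longrightarrow> p \<notin> B"
  unfolding ext_def by auto

lemma facet_meets:
  assumes "ext B = {}" "p \<in> M"
  obtains b where "b \<in> B" "cls b = cls p"
proof -
  have "p \<notin> ext B" using assms by simp
  then show thesis using assms(2) that unfolding ext_def by auto
qed

lemma indep_subset: "indep B \<Longrightarrow> p \<in> B \<Longrightarrow> p \<in> M"
  unfolding indep_def by auto

lemma indep_eq: "indep B \<Longrightarrow> p \<in> B \<Longrightarrow> q \<in> B \<Longrightarrow> cls p = cls q \<Longrightarrow> p = q"
  unfolding indep_def inj_on_def by auto

lemma facet_exists: "\<exists>B. indep B \<and> ext B = {}"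
proof -
  have fin: "finite (Collect indep)"
    by (rule finite_subset[of _ "Pow M"]) (auto simp: indep_def finite_M)
  have "{} \<in> Collect indep" by (simp add: indep_def)
  then obtain B where B: "indep B" "\<And>B'. indep B' \<Longrightarrow> B \<subseteq> B' \<Longrightarrow> B = B'"
    using finite_has_maximal[OF fin] by auto
  then have "ext B = {}" using indep_insert ext_notin by blast
  with B(1) show ?thesis by blast
qed

lemma isolated_in_facet:
  assumes "isolated p" "ext B = {}" "indep B"
  shows "p \<in> B"
proof -
  obtain b where "b \<in> B" "cls b = cls p"
    using assms facet_meets unfolding isolated_def by metis
  with assms show ?thesis using indep_subset unfolding isolated_def by metis
qed

end

text \<open>\<open>g B = None\<close> encodes that the basis element \<open>B\<close> is sent to zero; \<open>homotopy\<close> compares the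
  coefficients of \<open>B'\<close> in the homotopy formula applied to \<open>B\<close>.\<close>

locale simple_contraction = partial_transversals M cls for M :: "'p set" and cls :: "'p \<Rightarrow> 'b" +
  fixes g :: "'p set \<Rightarrow> 'p set option" and d :: int
  assumes g_indep: "indep B \<Longrightarrow> g B = Some E \<Longrightarrow> indep E"
    and g_card: "indep B \<Longrightarrow> g B = Some E \<Longrightarrow> int (card E) = int (card B) - d"
    and homotopy: "indep B \<Longrightarrow> indep B' \<Longrightarrow>
      of_bool (B' = B) = (\<Sum>p \<in> ext B. of_bool (g (insert p B) = Some B')) +
        (of_bool (\<exists>E. g B = Some E \<and> (\<exists>p \<in> ext E. B' = insert p E)) :: bit)"
begin

text \<open>A facet has zero coboundary, so the formula says that the coboundary of
  \<open>g B\<close> is \<open>B\<close> alone. Hence \<open>g B\<close> is \<open>B\<close> without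
  some \<open>p\<close>, and another element in the class of \<open>p\<close> would produce a second
  term.\<close>

lemma facet:
  assumes "indep B" "ext B = {}"
  obtains p where "p \<in> B" "isolated p" "g B = Some (B - {p})"
proof -
  have hom: "of_bool (B' = B) = (of_bool (\<exists>E. g B = Some E \<and> (\<exists>p \<in> ext E. B' = insert p E)) :: bit)"
    if "indep B'" for B'
    using homotopy[OF assms(1) that] assms(2) by simp
  obtain E p where E: "g B = Some E" "p \<in> ext E" "B = insert p E"
    using hom[OF assms(1)] by (auto split: if_splits simp: of_bool_def)
  have "q = p" if "q \<in> M" "cls q = cls p" for q
  proof -
    have q: "q \<in> ext E" using E(2) that unfolding ext_def by auto
    then have "indep (insert q E)" using g_indep[OF assms(1) E(1)] indep_insert by blast
    from hom[OF this] have "insert q E = B" using E(1) q by (auto split: if_splits simp: of_bool_def)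
    then show "q = p" using E(2,3) q ext_notin by blast
  qed
  then have "isolated p" using E(2) unfolding isolated_def ext_def by auto
  moreover have "E = B - {p}" using E ext_notin by blast
  ultimately show thesis using that[of p] E by auto
qed

text \<open>\<open>F\<close> is a ridge: \<open>ext F\<close> is the whole class of
  \<open>w\<close>, and every \<open>insert r F\<close> with \<open>r\<close> in it is a facet. The
  formula at \<open>F\<close> ties together what \<open>g\<close> removes from these facets.\<close>

lemma facets_through_ridge:
  assumes F: "indep F" and w: "w \<in> ext F" "\<not> isolated w" "ext (insert w F) = {}"
  shows "\<exists>p \<in> F. \<forall>r \<in> ext F. g (insert r F) = Some (insert r F - {p})"
proof -
  have cls: "cls r = cls w" if "r \<in> ext F" for r
    using that w(3) unfolding ext_def by auto
  have niso: "\<not> isolated r" if "r \<in> ext F" for r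
    using cls[OF that] w that unfolding isolated_def ext_def by (metis (no_types, lifting) mem_Collect_eq)
  have "\<exists>p \<in> F. g (insert r F) = Some (insert r F - {p})" if r: "r \<in> ext F" for r
  proof -
    have "ext (insert r F) = ext (insert w F)"
      using cls[OF r] unfolding ext_def by auto
    then obtain p where "p \<in> insert r F" "isolated p" "g (insert r F) = Some (insert r F - {p})"
      using facet[of "insert r F"] indep_insert[OF F r] w(3) by auto
    with niso[OF r] show ?thesis by blast
  qed
  then obtain P where P: "\<And>r. r \<in> ext F \<Longrightarrow> P r \<in> F"
    "\<And>r. r \<in> ext F \<Longrightarrow> g (insert r F) = Some (insert r F - {P r})" by metis
  \<comment> \<open>The facet over \<open>r\<close> loses \<open>P r\<close>, an element of
    \<open>F\<close>, and so keeps \<open>r\<close>. Hence \<open>F\<close> is not the image of any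
    of these facets and must come from the coboundary of \<open>G\<close>.\<close>
  have "(\<Sum>r \<in> ext F. of_bool (g (insert r F) = Some F)) = (0 :: bit)"
    using P by (intro sum_of_bool_none) (metis DiffD2 insertI1 option.inject)
  with homotopy[OF F F] obtain G p where G: "g F = Some G" "p \<in> ext G" "F = insert p G"
    by (auto split: if_splits simp: of_bool_def)
  have "P r = p" if r: "r \<in> ext F" for r
  proof -
    let ?E = "insert r F - {P r}"
    have rF: "r \<notin> F" using ext_notin[OF r] .
    then have rE: "r \<in> ?E" using P(1)[OF r] by auto
    \<comment> \<open>\<open>?E\<close> occurs exactly once among the images of the facets, since
      the other images miss \<open>r\<close>. It differs from \<open>F\<close>, so the coboundary of
      \<open>G\<close> has to cancel it; as \<open>G\<close> is \<open>F\<close> without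
      \<open>p\<close>, this forces \<open>P r = p\<close>.\<close>
    have "g (insert q F) \<noteq> Some ?E" if "q \<in> ext F" "q \<noteq> r" for q
    proof -
      have "r \<notin> insert q F - {P q}" using rF that(2) by auto
      with rE have "insert q F - {P q} \<noteq> ?E" by metis
      with P(2)[OF that(1)] show ?thesis by simp
    qed
    then have "(\<Sum>q \<in> ext F. of_bool (g (insert q F) = Some ?E)) = (1 :: bit)"
      using r P(2)[OF r] finite_ext by (intro sum_of_bool_unique[of _ r]) auto
    moreover have "?E \<noteq> F" using rE rF by blast
    moreover have "indep ?E" using indep_insert[OF F r] indep_remove by blast
    ultimately have "\<exists>q \<in> ext G. ?E = insert q G"
      using homotopy[OF F, of ?E] G(1) by (auto split: if_splits simp: of_bool_def)
    then obtain q where q: "q \<in> ext G" "?E = insert q G" by blast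
    show "P r = p"
      using q(2) rE rF G(3) ext_notin[OF G(2)] P(1)[OF r] by blast
  qed
  with P G show ?thesis by auto
qed

text \<open>Exchange argument: some \<open>w\<close> in \<open>B\<close> but not in
  \<open>B'\<close> is replaced by the element \<open>v\<close> of \<open>B'\<close> in the same
  class. Both facets contain the ridge \<open>B - {w}\<close>, so \<open>g\<close> removes the same
  element from them, and the new facet is closer to \<open>B'\<close>.\<close>

lemma facets_same_removal:
  assumes "indep B" "ext B = {}" "g B = Some (B - {p})" "p \<in> B"
    and "indep B'" "ext B' = {}"
  shows "g B' = Some (B' - {p})"
  using assms
proof (induction "card (B - B')" arbitrary: B rule: less_induct)
  case less
  show ?case
  proof (cases "B \<subseteq> B'")
    case True
    have "x \<in> B" if x: "x \<in> B'" for x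
    proof -
      obtain b where "b \<in> B" "cls b = cls x"
        using facet_meets[OF less.prems(2) indep_subset[OF less.prems(5) x]] .
      then show "x \<in> B" using True x indep_eq[OF less.prems(5)] by (metis subsetD)
    qed
    with True have "B = B'" by blast
    then show ?thesis using less.prems by simp
  next
    case False
    then obtain w where w: "w \<in> B" "w \<notin> B'" by blast
    obtain v where v: "v \<in> B'" "cls v = cls w"
      using facet_meets[OF less.prems(6) indep_subset[OF less.prems(1) w(1)]] .
    have vw: "v \<noteq> w" "v \<notin> B"
      using v w indep_eq[OF less.prems(1)] by auto
    let ?F = "B - {w}"
    have F: "indep ?F" "insert w ?F = B" using less.prems(1) w indep_remove by auto
    have wF: "w \<in> ext ?F" "v \<in> ext ?F"
      using less.prems(1,5) w v unfolding indep_def ext_def inj_on_def by auto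
    have "\<not> isolated w"
      using vw v less.prems(5) unfolding isolated_def indep_def by auto
    then obtain p' where p': "p' \<in> ?F" "\<forall>r \<in> ext ?F. g (insert r ?F) = Some (insert r ?F - {p'})"
      using facets_through_ridge[OF F(1) wF(1)] F(2) less.prems(2) by auto
    then have "g B = Some (B - {p'})" using wF(1) F(2) by metis
    then have "B - {p} = B - {p'}" using less.prems(3) by simp
    then have "p = p'" using less.prems(4) p'(1) by blast
    let ?B = "insert v ?F"
    have "card (?B - B') < card (B - B')"
      using w v finite_indep[OF less.prems(1)] by (intro psubset_card_mono) auto
    moreover have "indep ?B" using indep_insert[OF F(1) wF(2)] .
    moreover have "ext ?B = {}"
    proof -
      have "cls ` ?B = cls ` B" using v(2) w(1) by (auto simp: image_iff)
      then show ?thesis using less.prems(2) unfolding ext_def by simp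
    qed
    moreover have "g ?B = Some (?B - {p})" using p'(2) wF \<open>p = p'\<close> by auto
    moreover have "p \<in> ?B" using p'(1) \<open>p = p'\<close> by auto
    ultimately show ?thesis using less.hyps less.prems(5,6) by blast
  qed
qed

theorem contraction_is_removal:
  obtains p where "isolated p"
    "\<And>B. indep B \<Longrightarrow> g B = (if p \<in> B then Some (B - {p}) else None)"
proof -
  obtain B0 where B0: "indep B0" "ext B0 = {}" using facet_exists by (elim exE conjE)
  then obtain p where p: "p \<in> B0" "isolated p" "g B0 = Some (B0 - {p})"
    using facet by metis
  have "int (card (B0 - {p})) = int (card B0) - 1"
    using card_Suc_Diff1[OF finite_indep[OF B0(1)] p(1)] by linarith
  \<comment> \<open>The degree is read off at a single facet and then holds for all
    \<open>B\<close>.\<close>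
  then have d: "d = 1" using g_card[OF B0(1) p(3)] by simp
  have "g B = (if p \<in> B then Some (B - {p}) else None)" if "indep B" for B
    using that
  proof (induction "card (M - B)" arbitrary: B rule: less_induct)
    case less
    note B = \<open>indep B\<close>
    show ?case
    proof (cases "ext B = {}")
      case True
      then show ?thesis
        using facets_same_removal[OF B0 p(3,1) B True] isolated_in_facet[OF p(2) True B] by simp
    next
      case False
      then obtain r0 where r0: "r0 \<in> ext B" by blast
      have IH: "g (insert r B) = (if p \<in> insert r B then Some (insert r B - {p}) else None)"
        if r: "r \<in> ext B" for r
      proof -
        have "card (M - insert r B) < card (M - B)"
          using r finite_M unfolding ext_def by (intro psubset_card_mono) auto
        then show ?thesis using less.hyps indep_insert[OF B r] by blast
      qed
      show ?thesis
      proof (cases "p \<in> B")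
        case True
        have inB: "r \<notin> B" "r \<noteq> p" if "r \<in> ext B" for r using ext_notin[OF that] True by auto
        \<comment> \<open>Each \<open>insert r (B - {p})\<close> must be a coboundary term of
          \<open>g B\<close>: for \<open>r\<close> in \<open>ext B\<close> it is the image of
          \<open>insert r B\<close> and has to be cancelled, and for \<open>r = p\<close> it is
          \<open>B\<close> itself, the left-hand side of the formula.\<close>
        have hom: "\<exists>E. g B = Some E \<and> (\<exists>q \<in> ext E. insert r (B - {p}) = insert q E)"
          if r: "r \<in> insert p (ext B)" for r
        proof -
          let ?B' = "insert r (B - {p})"
          have "(\<Sum>q \<in> ext B. of_bool (g (insert q B) = Some ?B')) = (of_bool (r \<noteq> p) :: bit)"
          proof (cases "r = p")
            case True
            then show ?thesis using IH inB \<open>p \<in> B\<close>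
              by (auto intro!: sum_of_bool_none)
          next
            case False
            then have "r \<in> ext B" using r by auto
            with IH inB True show ?thesis
              using False by (subst sum_of_bool_unique[of _ r]) (auto intro: finite_ext)
          qed
          moreover have "?B' = B \<longleftrightarrow> r = p" using True r inB by auto
          moreover have "indep ?B'"
          proof -
            have "r \<in> ext (B - {p})"
              using r B True unfolding ext_def indep_def inj_on_def by auto
            then show ?thesis using indep_insert indep_remove B by blast
          qed
          ultimately show ?thesis
            using homotopy[OF B, of ?B'] by (auto split: if_splits simp: of_bool_def)
        qed
        obtain E q where E: "g B = Some E" "q \<in> ext E" "insert p (B - {p}) = insert q E"
          using hom[of p] by auto
        \<comment> \<open>A second coboundary term, which misses \<open>p\<close>, shows that
          \<open>p\<close> is not in \<open>E\<close>. It is available because \<open>B\<close> is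
          not a facet.\<close>
        obtain q' where q': "insert r0 (B - {p}) = insert q' E" using hom[of r0] r0 E(1) by auto
        have "p \<notin> insert r0 (B - {p})" using inB[OF r0] by auto
        then have "p \<notin> E" unfolding q' by auto
        with E(3) have "q = p" by (metis insertE insertI1)
        have "E = insert q E - {q}" using ext_notin[OF E(2)] by simp
        also have "\<dots> = insert p (B - {p}) - {p}" unfolding E(3) \<open>q = p\<close> ..
        finally have "E = B - {p}" by simp
        then show ?thesis using E(1) True by simp
      next
        case False
        have pB: "p \<in> ext B"
        proof (rule ccontr)
          assume "p \<notin> ext B"
          then obtain b where "b \<in> B" "cls b = cls p"
            using p(2) unfolding isolated_def ext_def by auto
          with False p(2) show False using indep_subset[OF B] unfolding isolated_def by metis
        qed
        \<comment> \<open>Among the extensions of \<open>B\<close> only \<open>insert p B\<close>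
          has a nonzero image, namely \<open>B\<close>. So \<open>g B\<close>, if nonzero, would
          have zero coboundary.\<close>
        have "g B = None"
        proof (rule ccontr)
          assume "g B \<noteq> None"
          then obtain E where E: "g B = Some E" by auto
          have iE: "indep E" using g_indep[OF B E] .
          have "card E < card B" using g_card[OF B E] d by linarith
          then have "card (cls ` E) < card (cls ` B)"
            using B iE unfolding indep_def by (simp add: card_image)
          \<comment> \<open>Being smaller than \<open>B\<close>, the set \<open>E\<close> misses a
            class that \<open>B\<close> meets, so it can be extended and its coboundary is
            nonzero.\<close>
          then have "\<not> cls ` B \<subseteq> cls ` E" using card_mono finite_indep[OF iE]
            by (metis finite_imageI linorder_not_le)
          then obtain q where q: "q \<in> ext E" using B unfolding ext_def indep_def by auto
          let ?B' = "insert q E"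
          have iB': "indep ?B'" using indep_insert[OF iE q] .
          have "(\<Sum>r \<in> ext B. of_bool (g (insert r B) = Some ?B')) = (of_bool (?B' = B) :: bit)"
          proof (cases "?B' = B")
            case True
            with pB show ?thesis using IH \<open>p \<notin> B\<close> by (subst sum_of_bool_unique[of _ p]) (auto intro: finite_ext split: if_splits)
          next
            case F: False
            have "g (insert r B) \<noteq> Some ?B'" if r: "r \<in> ext B" for r
              using IH[OF r] \<open>p \<notin> B\<close> F by (auto split: if_splits)
            with F show ?thesis by (auto intro!: sum_of_bool_none)
          qed
          with homotopy[OF B iB'] have "\<not> (\<exists>E. g B = Some E \<and> (\<exists>p \<in> ext E. ?B' = insert p E))"
            by (auto split: if_splits simp: of_bool_def)
          with E q show False by blast
        qed
        then show ?thesis using False by simp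
      qed
    qed
  qed
  with p(2) that show thesis by blast
qed

end

section \<open>Viable strand diagrams\<close>

text \<open>Over the two-element field a chain amounts to a finite set of strand diagrams, and in
  this form multiplication by an idempotent is a filter.\<close>

definition chain_of :: "strands set \<Rightarrow> chain" where
  "chain_of F = (\<Sum>\<nu> \<in> F. basic \<nu>)"

lemma lookup_chain_of:
  assumes "finite F"
  shows "Poly_Mapping.lookup (chain_of F) \<nu> = of_bool (\<nu> \<in> F)"
proof -
  have "Poly_Mapping.lookup (chain_of F) \<nu> = (\<Sum>\<kappa> \<in> F. if \<kappa> = \<nu> then 1 else 0)"
    unfolding chain_of_def lookup_sum basic_def lookup_single when_def by (rule refl)
  then show ?thesis using assms by simp
qed

lemma keys_chain_of: "finite F \<Longrightarrow> Poly_Mapping.keys (chain_of F) = F"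
  by (auto simp: in_keys_iff lookup_chain_of)

lemma finite_points: "finite (points Z)"
proof -
  have "points Z = (SIGMA i:{1..num_intervals Z}. {0..num_places Z i + 1})"
    unfolding points_def by auto
  then show ?thesis by simp
qed

lemma places_subset_points: "places Z \<subseteq> points Z"
  unfolding places_def points_def by auto

lemma finite_places: "finite (places Z)"
  using finite_subset[OF places_subset_points finite_points] .

lemma finite_sections: "finite (sections Z s)"
  by (rule finite_subset[of _ "Pow (points Z)"]) (auto simp: sections_def finite_points)

lemma inv_count_Id_on [simp]: "inv_count (Id_on S) = 0"
proof -
  have "crossings (Id_on S) = {}" unfolding crossings_def point_less_def by auto
  then show ?thesis unfolding inv_count_def by simp
qed

lemma strand_mult_Id_on_left: "strand_mult (Id_on S) \<nu> = (if Domain \<nu> = S then basic \<nu> else 0)"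
proof (cases "Domain \<nu> = S")
  case True
  then have "Id_on S O \<nu> = \<nu>" by auto
  with True show ?thesis unfolding strand_mult_def by simp
qed (auto simp: strand_mult_def)

lemma strand_mult_Id_on_right: "strand_mult \<nu> (Id_on S) = (if Range \<nu> = S then basic \<nu> else 0)"
proof (cases "Range \<nu> = S")
  case True
  then have "\<nu> O Id_on S = \<nu>" by auto
  with True show ?thesis unfolding strand_mult_def by simp
qed (auto simp: strand_mult_def)

lemma inj_Id_on: "inj_on Id_on A"
  by (rule inj_onI) (metis Domain_Id_on)

lemma idem_eq_chain_of: "idem Z s = chain_of (Id_on ` sections Z s)"
  unfolding idem_def chain_of_def by (simp add: sum.reindex[OF inj_Id_on])

text \<open>Only the summand \<open>Id_on (Domain \<nu>)\<close> has a nonzero product with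
  \<open>\<nu>\<close>, and that product is \<open>\<nu>\<close>; so nothing cancels.\<close>

lemma idem_mult_left:
  assumes "finite N"
  shows "idem Z s \<odot> chain_of N = chain_of {\<nu> \<in> N. Domain \<nu> \<in> sections Z s}"
proof -
  have "idem Z s \<odot> chain_of N = (\<Sum>S \<in> sections Z s. \<Sum>\<nu> \<in> N. strand_mult (Id_on S) \<nu>)"
    unfolding chain_mult_def idem_eq_chain_of
    using assms by (simp add: keys_chain_of finite_sections sum.reindex[OF inj_Id_on])
  also have "\<dots> = (\<Sum>\<nu> \<in> N. \<Sum>S \<in> sections Z s. if S = Domain \<nu> then basic \<nu> else 0)"
    by (subst sum.swap) (simp add: strand_mult_Id_on_left eq_commute cong: if_cong)
  also have "\<dots> = chain_of {\<nu> \<in> N. Domain \<nu> \<in> sections Z s}"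
    unfolding chain_of_def using assms by (simp add: finite_sections sum.inter_filter)
  finally show ?thesis .
qed

lemma idem_mult_right:
  assumes "finite N"
  shows "chain_of N \<odot> idem Z t = chain_of {\<nu> \<in> N. Range \<nu> \<in> sections Z t}"
proof -
  have "chain_of N \<odot> idem Z t = (\<Sum>\<nu> \<in> N. \<Sum>S \<in> sections Z t. strand_mult \<nu> (Id_on S))"
    unfolding chain_mult_def idem_eq_chain_of
    using assms by (simp add: keys_chain_of finite_sections sum.reindex[OF inj_Id_on])
  also have "\<dots> = (\<Sum>\<nu> \<in> N. \<Sum>S \<in> sections Z t. if S = Range \<nu> then basic \<nu> else 0)"
    by (simp add: strand_mult_Id_on_right eq_commute cong: if_cong)
  also have "\<dots> = chain_of {\<nu> \<in> N. Range \<nu> \<in> sections Z t}"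
    unfolding chain_of_def using assms by (simp add: finite_sections sum.inter_filter)
  finally show ?thesis .
qed

definition horizontals :: "arc_diagram \<Rightarrow> nat set \<Rightarrow> strands \<Rightarrow> nat set \<Rightarrow> point set set" where
  "horizontals Z s \<mu> t = {U. U \<subseteq> points Z - (Domain \<mu> \<union> Range \<mu>) \<and>
     Domain \<mu> \<union> U \<in> sections Z s \<and> Range \<mu> \<union> U \<in> sections Z t}"

lemma finite_horizontals: "finite (horizontals Z s \<mu> t)"
  by (rule finite_subset[of _ "Pow (points Z)"]) (auto simp: horizontals_def finite_points)

lemma inj_horizontals: "inj_on (\<lambda>U. \<mu> \<union> Id_on U) (Pow (points Z - (Domain \<mu> \<union> Range \<mu>)))"
proof (rule inj_on_inverseI)
  fix U assume "U \<in> Pow (points Z - (Domain \<mu> \<union> Range \<mu>))"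
  then show "Domain (\<mu> \<union> Id_on U) - Domain \<mu> = U" by auto
qed

lemma inj_on_horizontals: "inj_on (\<lambda>U. \<mu> \<union> Id_on U) (horizontals Z s \<mu> t)"
  by (rule inj_on_subset[OF inj_horizontals]) (auto simp: horizontals_def)

lemma diagram_eq_chain_of:
  "diagram Z s \<mu> t = chain_of ((\<lambda>U. \<mu> \<union> Id_on U) ` horizontals Z s \<mu> t)"
proof -
  let ?N = "(\<lambda>U. \<mu> \<union> Id_on U) ` Pow (points Z - (Domain \<mu> \<union> Range \<mu>))"
  have fin: "finite ?N" using finite_points by auto
  have "add_horizontals Z \<mu> = chain_of ?N"
    unfolding add_horizontals_def chain_of_def by (simp add: sum.reindex[OF inj_horizontals])
  then have "diagram Z s \<mu> t =
      chain_of {\<nu> \<in> {\<nu> \<in> ?N. Domain \<nu> \<in> sections Z s}. Range \<nu> \<in> sections Z t}"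
    unfolding diagram_def using fin by (simp add: idem_mult_left idem_mult_right)
  also have "{\<nu> \<in> {\<nu> \<in> ?N. Domain \<nu> \<in> sections Z s}. Range \<nu> \<in> sections Z t} =
      (\<lambda>U. \<mu> \<union> Id_on U) ` horizontals Z s \<mu> t"
  proof -
    have "{x \<in> {x \<in> g ` A. Q x}. R x} = g ` {U \<in> A. Q (g U) \<and> R (g U)}"
      for g :: "point set \<Rightarrow> strands" and A Q R
      by auto
    then show ?thesis
      unfolding horizontals_def by (simp add: Domain_Un_eq Range_Un_eq)
  qed
  finally show ?thesis .
qed

lemma diagram_eq_sum: "diagram Z s \<mu> t = (\<Sum>U \<in> horizontals Z s \<mu> t. basic (\<mu> \<union> Id_on U))"
  unfolding diagram_eq_chain_of chain_of_def by (simp add: sum.reindex[OF inj_on_horizontals])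

lemma keys_diagram:
  "Poly_Mapping.keys (diagram Z s \<mu> t) = (\<lambda>U. \<mu> \<union> Id_on U) ` horizontals Z s \<mu> t"
  unfolding diagram_eq_chain_of using finite_horizontals by (intro keys_chain_of) auto

lemma diagram_nonzero_iff: "diagram Z s \<mu> t \<noteq> 0 \<longleftrightarrow> horizontals Z s \<mu> t \<noteq> {}"
  unfolding keys_eq_empty[symmetric] keys_diagram by simp

section \<open>Strands and the steps they cover\<close>

text \<open>A step is named by its initial point, so the inequality is strict only at the end of the
  strand; a horizontal strand covers nothing.\<close>

definition covers :: "point \<times> point \<Rightarrow> step \<Rightarrow> bool" where
  "covers \<sigma> e \<longleftrightarrow> fst (fst \<sigma>) = fst e \<and> snd (fst \<sigma>) \<le> snd e \<and> snd e < snd (snd \<sigma>)"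

definition covered :: "strands \<Rightarrow> step set" where
  "covered \<mu> = {e. \<exists>\<sigma> \<in> \<mu>. covers \<sigma> e}"

lemma coveredI: "\<sigma> \<in> \<mu> \<Longrightarrow> covers \<sigma> e \<Longrightarrow> e \<in> covered \<mu>"
  unfolding covered_def by blast

lemma lookup_segment_class: "Poly_Mapping.lookup (segment_class x y) e = of_bool (covers (x, y) e)"
proof -
  have "Poly_Mapping.lookup (segment_class x y) e =
      (\<Sum>j \<in> {snd x..<snd y}. if j = snd e \<and> fst x = fst e then 1 else 0)"
    unfolding segment_class_def lookup_sum lookup_single when_def
    by (intro sum.cong) (auto simp: prod_eq_iff)
  also have "\<dots> = of_bool (covers (x, y) e)"
    by (cases "fst x = fst e") (auto simp: covers_def)
  finally show ?thesis .
qed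

lemma lookup_hclass: "Poly_Mapping.lookup (hclass \<mu>) e = (\<Sum>\<sigma> \<in> \<mu>. of_bool (covers \<sigma> e))"
  unfolding hclass_def lookup_sum by (intro sum.cong) (auto simp: lookup_segment_class)

definition disjoint_strands :: "strands \<Rightarrow> bool" where
  "disjoint_strands \<mu> \<longleftrightarrow> (\<forall>\<sigma> \<in> \<mu>. \<forall>\<tau> \<in> \<mu>. \<forall>e. covers \<sigma> e \<longrightarrow> covers \<tau> e \<longrightarrow> \<sigma> = \<tau>)"

lemma finite_strand_diagram: "strand_diagram Z \<mu> \<Longrightarrow> finite \<mu>"
  unfolding strand_diagram_def by (meson finite_SigmaI finite_points finite_subset)

lemma lookup_hclass_disjoint:
  assumes "finite \<mu>" "disjoint_strands \<mu>"
  shows "Poly_Mapping.lookup (hclass \<mu>) e = of_bool (e \<in> covered \<mu>)"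
proof (cases "e \<in> covered \<mu>")
  case True
  then obtain \<sigma> where \<sigma>: "\<sigma> \<in> \<mu>" "covers \<sigma> e" unfolding covered_def by auto
  have "(\<Sum>\<sigma> \<in> \<mu>. of_bool (covers \<sigma> e)) = (1 :: int)"
    using assms \<sigma> unfolding disjoint_strands_def by (intro sum_of_bool_unique[of _ \<sigma>]) blast+
  with True show ?thesis by (simp add: lookup_hclass)
next
  case False
  then have "(\<Sum>\<sigma> \<in> \<mu>. of_bool (covers \<sigma> e)) = (0 :: int)"
    by (intro sum_of_bool_none) (auto simp: covered_def)
  with False show ?thesis by (simp add: lookup_hclass)
qed

lemma hclass_eq_if_covered_eq:
  assumes "finite \<mu>" "disjoint_strands \<mu>" "finite \<mu>'" "disjoint_strands \<mu>'" "covered \<mu> = covered \<mu>'"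
  shows "hclass \<mu> = hclass \<mu>'"
  by (rule poly_mapping_eqI) (simp add: lookup_hclass_disjoint assms)

lemma strand_covers_steps:
  assumes "strand_diagram Z \<mu>" "\<sigma> \<in> \<mu>" "covers \<sigma> e"
  shows "e \<in> steps Z"
proof -
  obtain x y where \<sigma>: "\<sigma> = (x, y)" by (cases \<sigma>)
  with assms have "x \<in> points Z" "y \<in> points Z" "point_le x y"
    unfolding strand_diagram_def by auto
  with assms(3) show ?thesis
    unfolding \<sigma> covers_def points_def steps_def point_le_def by (auto split: prod.splits)
qed

text \<open>Two different strands over one step would give that step multiplicity at least
  2.\<close>

lemma viable_disjoint_strands:
  assumes "strand_diagram Z \<mu>" "viable Z (hclass \<mu>)"
  shows "disjoint_strands \<mu>"
  unfolding disjoint_strands_def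
proof (intro ballI allI impI)
  fix \<sigma> \<tau> e assume st: "\<sigma> \<in> \<mu>" "\<tau> \<in> \<mu>" "covers \<sigma> e" "covers \<tau> e"
  have fin: "finite \<mu>" using finite_strand_diagram[OF assms(1)] .
  show "\<sigma> = \<tau>"
  proof (rule ccontr)
    assume ne: "\<sigma> \<noteq> \<tau>"
    have "(\<Sum>\<rho> \<in> {\<sigma>, \<tau>}. of_bool (covers \<rho> e)) \<le> (\<Sum>\<rho> \<in> \<mu>. of_bool (covers \<rho> e) :: int)"
      using fin st by (intro sum_mono2) auto
    then have "2 \<le> Poly_Mapping.lookup (hclass \<mu>) e"
      using ne st by (simp add: lookup_hclass)
    moreover have "e \<in> steps Z" using strand_covers_steps[OF assms(1)] st by blast
    ultimately show False using assms(2) unfolding viable_def by fastforce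
  qed
qed

text \<open>Viability is recorded as disjointness, which can be checked strand by strand after a
  strand is cut or two strands are joined.\<close>

definition viable_strands :: "arc_diagram \<Rightarrow> strands \<Rightarrow> bool" where
  "viable_strands Z \<mu> \<longleftrightarrow> strand_diagram Z \<mu> \<and> no_horizontal \<mu> \<and> disjoint_strands \<mu>"

lemma viable_strands_finite: "viable_strands Z \<mu> \<Longrightarrow> finite \<mu>"
  unfolding viable_strands_def using finite_strand_diagram by blast

lemma viable_strands_less:
  assumes "viable_strands Z \<mu>" "(x, y) \<in> \<mu>"
  shows "x \<in> points Z" "y \<in> points Z" "fst x = fst y" "snd x < snd y"
proof -
  show p: "x \<in> points Z" "y \<in> points Z" "fst x = fst y"
    using assms unfolding viable_strands_def strand_diagram_def point_le_def by auto
  have "x \<noteq> y" using assms unfolding viable_strands_def no_horizontal_def by auto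
  moreover have "snd x \<le> snd y"
    using assms unfolding viable_strands_def strand_diagram_def point_le_def by auto
  ultimately show "snd x < snd y" using p(3) by (simp add: prod_eq_iff)
qed

lemma viable_strands_unique:
  assumes "viable_strands Z \<mu>" "\<sigma> \<in> \<mu>" "\<tau> \<in> \<mu>" "covers \<sigma> e" "covers \<tau> e"
  shows "\<sigma> = \<tau>"
  using assms unfolding viable_strands_def disjoint_strands_def by blast

section \<open>Support and breakpoints determine the strands\<close>

definition breakpoints :: "strands \<Rightarrow> point set" where
  "breakpoints \<mu> = Domain \<mu> \<inter> Range \<mu>"

text \<open>A strand starts at \<open>p\<close> either because the covered region starts there or
  because it is cut there. The case \<open>snd p = 0\<close> is separate because truncated
  subtraction makes \<open>step_before p\<close> equal to \<open>p\<close> at the start of an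
  interval.\<close>

lemma Domain_iff_covered:
  assumes \<mu>: "viable_strands Z \<mu>"
  shows "p \<in> Domain \<mu> \<longleftrightarrow>
    p \<in> covered \<mu> \<and> (snd p = 0 \<or> step_before p \<notin> covered \<mu> \<or> p \<in> breakpoints \<mu>)"
proof
  assume "p \<in> Domain \<mu>"
  then obtain y where y: "(p, y) \<in> \<mu>" by auto
  have cp: "covers (p, y) p" using viable_strands_less[OF \<mu> y] by (simp add: covers_def)
  moreover have "p \<in> Range \<mu>" if "snd p \<noteq> 0" "step_before p \<in> covered \<mu>"
  proof -
    from that obtain x z where xz: "(x, z) \<in> \<mu>" "covers (x, z) (step_before p)"
      unfolding covered_def by auto
    note l = viable_strands_less[OF \<mu> xz(1)]
    have "\<not> covers (x, z) p"
      using viable_strands_unique[OF \<mu> y xz(1) cp] xz(2) that(1)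
      by (auto simp: covers_def step_before_def)
    then have "z = p" using xz(2) l by (auto simp: covers_def step_before_def prod_eq_iff)
    then show ?thesis using xz(1) by auto
  qed
  ultimately show "p \<in> covered \<mu> \<and> (snd p = 0 \<or> step_before p \<notin> covered \<mu> \<or> p \<in> breakpoints \<mu>)"
    using y \<open>p \<in> Domain \<mu>\<close> unfolding covered_def breakpoints_def by auto
next
  assume R: "p \<in> covered \<mu> \<and> (snd p = 0 \<or> step_before p \<notin> covered \<mu> \<or> p \<in> breakpoints \<mu>)"
  then obtain x y where xy: "(x, y) \<in> \<mu>" "covers (x, y) p" unfolding covered_def by auto
  show "p \<in> Domain \<mu>"
  proof (rule ccontr)
    assume "p \<notin> Domain \<mu>"
    then have "x \<noteq> p" using xy by auto
    then have "snd x < snd p" using xy(2) by (auto simp: covers_def prod_eq_iff)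
    then have "covers (x, y) (step_before p)" "snd p \<noteq> 0"
      using xy(2) by (auto simp: covers_def step_before_def)
    then have "p \<in> breakpoints \<mu>" using R coveredI[OF xy(1), of "step_before p"] by simp
    with \<open>p \<notin> Domain \<mu>\<close> show False unfolding breakpoints_def by auto
  qed
qed

lemma Range_iff_covered:
  assumes \<mu>: "viable_strands Z \<mu>"
  shows "p \<in> Range \<mu> \<longleftrightarrow>
    snd p \<noteq> 0 \<and> step_before p \<in> covered \<mu> \<and> (p \<notin> covered \<mu> \<or> p \<in> breakpoints \<mu>)"
proof
  assume "p \<in> Range \<mu>"
  then obtain x where x: "(x, p) \<in> \<mu>" by auto
  note l = viable_strands_less[OF \<mu> x]
  have cp: "covers (x, p) (step_before p)" using l by (auto simp: covers_def step_before_def)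
  moreover have "p \<in> Domain \<mu>" if "p \<in> covered \<mu>"
  proof -
    from that obtain y z where yz: "(y, z) \<in> \<mu>" "covers (y, z) p" unfolding covered_def by auto
    have "\<not> covers (y, z) (step_before p)"
      using viable_strands_unique[OF \<mu> x yz(1) cp] yz(2) by (auto simp: covers_def)
    then have "y = p" using yz(2) l by (auto simp: covers_def step_before_def prod_eq_iff)
    then show ?thesis using yz(1) by auto
  qed
  ultimately show "snd p \<noteq> 0 \<and> step_before p \<in> covered \<mu> \<and> (p \<notin> covered \<mu> \<or> p \<in> breakpoints \<mu>)"
    using x l \<open>p \<in> Range \<mu>\<close> unfolding covered_def breakpoints_def by auto
next
  assume R: "snd p \<noteq> 0 \<and> step_before p \<in> covered \<mu> \<and> (p \<notin> covered \<mu> \<or> p \<in> breakpoints \<mu>)"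
  then obtain x y where xy: "(x, y) \<in> \<mu>" "covers (x, y) (step_before p)" unfolding covered_def by auto
  note l = viable_strands_less[OF \<mu> xy(1)]
  show "p \<in> Range \<mu>"
  proof (rule ccontr)
    assume "p \<notin> Range \<mu>"
    then have "y \<noteq> p" using xy by auto
    then have "covers (x, y) p"
      using xy(2) l R by (auto simp: covers_def step_before_def prod_eq_iff)
    then have "p \<in> breakpoints \<mu>" using R coveredI[OF xy(1)] by blast
    with \<open>p \<notin> Range \<mu>\<close> show False unfolding breakpoints_def by auto
  qed
qed

text \<open>Support and breakpoints fix the sets of initial and of final points. They also fix the
  bijection between them, since no final point lies strictly inside a strand.\<close>

lemma viable_strands_subset:
  assumes \<mu>: "viable_strands Z \<mu>" and \<mu>': "viable_strands Z \<mu>'"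
    and eq: "covered \<mu> = covered \<mu>'" "breakpoints \<mu> = breakpoints \<mu>'"
  shows "\<mu> \<subseteq> \<mu>'"
proof
  have D: "Domain \<mu> = Domain \<mu>'"
    using Domain_iff_covered[OF \<mu>] Domain_iff_covered[OF \<mu>'] eq by blast
  have R: "Range \<mu> = Range \<mu>'"
    using Range_iff_covered[OF \<mu>] Range_iff_covered[OF \<mu>'] eq by blast
  \<comment> \<open>A final point strictly inside a strand would be covered, hence a breakpoint, and
    the strand starting there would overlap the given one.\<close>
  have shorter: "\<not> snd y' < snd y"
    if \<nu>: "viable_strands Z \<nu>" and xy: "(x, y) \<in> \<nu>" "y' \<in> Range \<nu>" "fst x = fst y'" "snd x < snd y'"
    for \<nu> x y y'
  proof
    assume "snd y' < snd y"
    then have c: "covers (x, y) y'" using that by (simp add: covers_def)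
    then have "y' \<in> covered \<nu>" using xy unfolding covered_def by auto
    then have "y' \<in> Domain \<nu>" using Range_iff_covered[OF \<nu>, of y'] xy(2) unfolding breakpoints_def by auto
    then obtain z where z: "(y', z) \<in> \<nu>" by auto
    have "covers (y', z) y'" using viable_strands_less[OF \<nu> z] by (simp add: covers_def)
    with viable_strands_unique[OF \<nu> xy(1) z c] xy(4) show False by auto
  qed
  fix \<sigma> assume \<sigma>: "\<sigma> \<in> \<mu>"
  obtain x y where xy: "\<sigma> = (x, y)" by (cases \<sigma>)
  then have "x \<in> Domain \<mu>'" using \<sigma> D by auto
  then obtain y' where y': "(x, y') \<in> \<mu>'" by auto
  note l = viable_strands_less[OF \<mu> \<sigma>[unfolded xy]] viable_strands_less[OF \<mu>' y']
  have "\<not> snd y' < snd y" using shorter[OF \<mu> \<sigma>[unfolded xy], of y'] R y' l by auto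
  moreover have "\<not> snd y < snd y'" using shorter[OF \<mu>' y', of y] R \<sigma> xy l by auto
  ultimately have "y = y'" using l by (simp add: prod_eq_iff)
  then show "\<sigma> \<in> \<mu>'" using xy y' by simp
qed

lemma viable_strands_eqI:
  assumes "viable_strands Z \<mu>" "viable_strands Z \<mu>'"
    and "covered \<mu> = covered \<mu>'" "breakpoints \<mu> = breakpoints \<mu>'"
  shows "\<mu> = \<mu>'"
  using viable_strands_subset[OF assms] viable_strands_subset[OF assms(2,1) assms(3,4)[symmetric]] by blast

section \<open>Breaking and joining strands\<close>

definition passes :: "point \<times> point \<Rightarrow> point \<Rightarrow> bool" where
  "passes \<sigma> p \<longleftrightarrow> point_less (fst \<sigma>) p \<and> point_less p (snd \<sigma>)"

definition passed :: "strands \<Rightarrow> point set" where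
  "passed \<mu> = {p. \<exists>\<sigma> \<in> \<mu>. passes \<sigma> p}"

text \<open>If no strand passes \<open>p\<close> this leaves \<open>\<mu>\<close> unchanged. In
  viable \<open>\<mu>\<close> at most one strand passes \<open>p\<close>, and it is cut into
  two.\<close>

definition break_at :: "point \<Rightarrow> strands \<Rightarrow> strands" where
  "break_at p \<mu> = {\<sigma> \<in> \<mu>. \<not> passes \<sigma> p} \<union>
     {(x, p) | x. \<exists>y. (x, y) \<in> \<mu> \<and> passes (x, y) p} \<union>
     {(p, y) | y. \<exists>x. (x, y) \<in> \<mu> \<and> passes (x, y) p}"

lemma passes_covers:
  assumes "passes \<sigma> p"
  shows "covers \<sigma> p" "covers \<sigma> (step_before p)" "snd p \<noteq> 0"
  using assms by (auto simp: passes_def covers_def point_less_def step_before_def)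

lemma passedE:
  assumes "p \<in> passed \<mu>"
  obtains x y where "(x, y) \<in> \<mu>" "passes (x, y) p"
  using assms unfolding passed_def by auto

lemma passed_in_places:
  assumes "viable_strands Z \<mu>" "p \<in> passed \<mu>"
  shows "p \<in> places Z"
proof -
  obtain x y where xy: "(x, y) \<in> \<mu>" "passes (x, y) p" using passedE[OF assms(2)] .
  have "x \<in> points Z" "y \<in> points Z" using viable_strands_less[OF assms(1) xy(1)] by auto
  with xy(2) show ?thesis
    by (cases x; cases y; cases p)
      (auto simp: passes_def point_less_def points_def places_def)
qed

lemma breakpoints_in_places:
  assumes "viable_strands Z \<mu>" "p \<in> breakpoints \<mu>"
  shows "p \<in> places Z"
proof -
  obtain x y where "(x, p) \<in> \<mu>" "(p, y) \<in> \<mu>" using assms(2) unfolding breakpoints_def by auto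
  note l = viable_strands_less[OF assms(1) this(1)] viable_strands_less[OF assms(1) this(2)]
  then show ?thesis by (auto simp: points_def places_def case_prod_beta)
qed

lemma breakpoints_covered:
  assumes "viable_strands Z \<mu>" "p \<in> breakpoints \<mu>"
  shows "snd p \<noteq> 0" "step_before p \<in> covered \<mu>" "p \<in> covered \<mu>"
proof -
  have "p \<in> Domain \<mu>" "p \<in> Range \<mu>" using assms(2) unfolding breakpoints_def by auto
  then show "snd p \<noteq> 0" "step_before p \<in> covered \<mu>" "p \<in> covered \<mu>"
    using Domain_iff_covered[OF assms(1), of p] Range_iff_covered[OF assms(1), of p] by blast+
qed

text \<open>The dichotomy behind the coordinates: between two covered steps, a strand either runs on
  or is replaced by the next one.\<close>

lemma passed_iff:
  assumes \<mu>: "viable_strands Z \<mu>"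
  shows "p \<in> passed \<mu> \<longleftrightarrow>
    snd p \<noteq> 0 \<and> step_before p \<in> covered \<mu> \<and> p \<in> covered \<mu> \<and> p \<notin> breakpoints \<mu>"
proof
  assume "p \<in> passed \<mu>"
  then obtain x y where xy: "(x, y) \<in> \<mu>" "passes (x, y) p" using passedE by blast
  note c = passes_covers[OF xy(2)]
  have "p \<notin> Domain \<mu>"
  proof
    assume "p \<in> Domain \<mu>"
    then obtain z where z: "(p, z) \<in> \<mu>" by auto
    then have "covers (p, z) p" using viable_strands_less[OF \<mu> z] by (simp add: covers_def)
    then have "(p, z) = (x, y)" using viable_strands_unique[OF \<mu> z xy(1)] c by blast
    then show False using xy(2) by (simp add: passes_def point_less_def)
  qed
  then show "snd p \<noteq> 0 \<and> step_before p \<in> covered \<mu> \<and> p \<in> covered \<mu> \<and> p \<notin> breakpoints \<mu>"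
    using c coveredI[OF xy(1)] unfolding breakpoints_def by auto
next
  assume R: "snd p \<noteq> 0 \<and> step_before p \<in> covered \<mu> \<and> p \<in> covered \<mu> \<and> p \<notin> breakpoints \<mu>"
  then obtain x y where xy: "(x, y) \<in> \<mu>" "covers (x, y) (step_before p)" unfolding covered_def by auto
  note l = viable_strands_less[OF \<mu> xy(1)]
  have "p \<notin> Range \<mu>" using Range_iff_covered[OF \<mu>, of p] R by blast
  then have "y \<noteq> p" using xy(1) by auto
  then have "passes (x, y) p"
    using xy(2) l R by (auto simp: covers_def step_before_def passes_def point_less_def prod_eq_iff)
  then show "p \<in> passed \<mu>" using xy(1) unfolding passed_def by blast
qed

lemma passed_notin:
  assumes "viable_strands Z \<mu>" "p \<in> passed \<mu>"
  shows "p \<notin> Domain \<mu>" "p \<notin> Range \<mu>"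
  using assms(2) passed_iff[OF assms(1), of p] Domain_iff_covered[OF assms(1), of p]
    Range_iff_covered[OF assms(1), of p] by simp_all

lemma finite_passed: "viable_strands Z \<mu> \<Longrightarrow> finite (passed \<mu>)"
  using passed_in_places finite_places by (metis finite_subset subsetI)

lemma viable_strands_inj:
  assumes "viable_strands Z \<mu>" "(x, y) \<in> \<mu>" "(x', y') \<in> \<mu>"
  shows "x = x' \<longleftrightarrow> y = y'"
proof -
  have "inj_on fst \<mu>" "inj_on snd \<mu>"
    using assms(1) unfolding viable_strands_def strand_diagram_def by auto
  then have "fst (x, y) = fst (x', y') \<Longrightarrow> (x, y) = (x', y')"
    "snd (x, y) = snd (x', y') \<Longrightarrow> (x, y) = (x', y')"
    using assms(2,3) by (blast dest: inj_onD)+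
  then show ?thesis by auto
qed

lemma break_at_eq:
  assumes \<mu>: "viable_strands Z \<mu>" and xy: "(x, y) \<in> \<mu>" "passes (x, y) p"
  shows "break_at p \<mu> = (\<mu> - {(x, y)}) \<union> {(x, p), (p, y)}"
proof -
  have uniq: "passes \<sigma> p \<longleftrightarrow> \<sigma> = (x, y)" if "\<sigma> \<in> \<mu>" for \<sigma>
    using viable_strands_unique[OF \<mu> that xy(1)] passes_covers(1) xy(2) by blast
  have "{\<sigma> \<in> \<mu>. \<not> passes \<sigma> p} = \<mu> - {(x, y)}" using uniq by blast
  moreover have "{(a, p) | a. \<exists>b. (a, b) \<in> \<mu> \<and> passes (a, b) p} = {(x, p)}"
    using uniq xy by blast
  moreover have "{(p, b) | b. \<exists>a. (a, b) \<in> \<mu> \<and> passes (a, b) p} = {(p, y)}"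
    using uniq xy by blast
  ultimately show ?thesis unfolding break_at_def by auto
qed

lemma inj_on_insertI: "inj_on f A \<Longrightarrow> f a \<notin> f ` A \<Longrightarrow> inj_on f (insert a A)"
  by auto

lemma covered_insert: "covered (insert \<sigma> \<mu>) = {e. covers \<sigma> e} \<union> covered \<mu>"
  unfolding covered_def by auto

lemma break_at_props:
  assumes \<mu>: "viable_strands Z \<mu>" and p: "p \<in> passed \<mu>"
  shows "viable_strands Z (break_at p \<mu>)" "covered (break_at p \<mu>) = covered \<mu>"
    "Domain (break_at p \<mu>) = insert p (Domain \<mu>)" "Range (break_at p \<mu>) = insert p (Range \<mu>)"
    "breakpoints (break_at p \<mu>) = insert p (breakpoints \<mu>)"
proof -
  obtain x y where xy: "(x, y) \<in> \<mu>" "passes (x, y) p" using passedE[OF p] .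
  define N where "N = \<mu> - {(x, y)}"
  have eq: "break_at p \<mu> = insert (x, p) (insert (p, y) N)"
    unfolding N_def break_at_eq[OF \<mu> xy] by auto
  have \<mu>N: "\<mu> = insert (x, y) N" unfolding N_def using xy by auto
  note l = viable_strands_less[OF \<mu> xy(1)]
  note n = passed_notin[OF \<mu> p]
  have pp: "p \<in> points Z" using passed_in_places[OF \<mu> p] places_subset_points by blast
  have lt: "fst x = fst p" "snd x < snd p" "fst y = fst p" "snd p < snd y"
    using xy(2) by (auto simp: passes_def point_less_def)
  then have ne: "x \<noteq> p" "p \<noteq> y" by auto
  have inj: "inj_on fst N" "inj_on snd N"
    using \<mu> unfolding N_def viable_strands_def strand_diagram_def by (auto intro: inj_on_diff)
  have uniq: "a = x \<longleftrightarrow> b = y" if "(a, b) \<in> \<mu>" for a b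
    using viable_strands_inj[OF \<mu> that xy(1)] .
  have notin: "x \<notin> fst ` N" "y \<notin> snd ` N" "p \<notin> fst ` N" "p \<notin> snd ` N"
    using uniq n unfolding N_def by force+
  have "inj_on fst (break_at p \<mu>)"
    unfolding eq using notin ne by (intro inj_on_insertI inj(1)) auto
  moreover have "inj_on snd (break_at p \<mu>)"
    unfolding eq using notin ne by (intro inj_on_insertI inj(2)) auto
  moreover have "break_at p \<mu> \<subseteq> points Z \<times> points Z"
    using \<mu> pp l unfolding eq N_def viable_strands_def strand_diagram_def by auto
  moreover have "\<forall>(a, b) \<in> break_at p \<mu>. point_le a b"
    using \<mu> lt unfolding eq N_def viable_strands_def strand_diagram_def by (auto simp: point_le_def)
  ultimately have "strand_diagram Z (break_at p \<mu>)" unfolding strand_diagram_def by blast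
  moreover have "no_horizontal (break_at p \<mu>)"
    using \<mu> ne unfolding eq N_def viable_strands_def no_horizontal_def by auto
  \<comment> \<open>The two halves share out the steps of the cut strand without overlap.
    Disjointness is then inherited by tracing each new strand to the old strand of which it is a
    part.\<close>
  moreover have cov: "covers (x, y) e \<longleftrightarrow> covers (x, p) e \<or> covers (p, y) e"
    and dis: "\<not> (covers (x, p) e \<and> covers (p, y) e)" for e
    using lt by (auto simp: covers_def)
  have "disjoint_strands (break_at p \<mu>)"
    unfolding disjoint_strands_def
  proof (intro ballI allI impI)
    fix \<sigma> \<tau> e assume *: "\<sigma> \<in> break_at p \<mu>" "\<tau> \<in> break_at p \<mu>" "covers \<sigma> e" "covers \<tau> e"
    have parent: "\<exists>\<rho> \<in> \<mu>. covers \<rho> e \<and> (\<sigma> = \<rho> \<and> \<rho> \<noteq> (x, y) \<or> \<rho> = (x, y) \<and> \<sigma> \<in> {(x, p), (p, y)})"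
      if "\<sigma> \<in> break_at p \<mu>" "covers \<sigma> e" for \<sigma>
    proof (cases "\<sigma> \<in> N")
      case True
      with that show ?thesis unfolding N_def by blast
    next
      case False
      with that have "\<sigma> \<in> {(x, p), (p, y)}" "covers (x, y) e" unfolding eq cov by auto
      with xy(1) show ?thesis by blast
    qed
    obtain \<rho> where \<rho>: "\<rho> \<in> \<mu>" "covers \<rho> e"
      "\<sigma> = \<rho> \<and> \<rho> \<noteq> (x, y) \<or> \<rho> = (x, y) \<and> \<sigma> \<in> {(x, p), (p, y)}"
      using parent[OF *(1,3)] by blast
    obtain \<rho>' where \<rho>': "\<rho>' \<in> \<mu>" "covers \<rho>' e"
      "\<tau> = \<rho>' \<and> \<rho>' \<noteq> (x, y) \<or> \<rho>' = (x, y) \<and> \<tau> \<in> {(x, p), (p, y)}"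
      using parent[OF *(2,4)] by blast
    have "\<rho> = \<rho>'" using viable_strands_unique[OF \<mu> \<rho>(1) \<rho>'(1) \<rho>(2) \<rho>'(2)] .
    with \<rho>(3) \<rho>'(3) show "\<sigma> = \<tau>" using *(3,4) dis[of e] by auto
  qed
  ultimately show "viable_strands Z (break_at p \<mu>)" unfolding viable_strands_def by blast
  show "covered (break_at p \<mu>) = covered \<mu>"
    unfolding eq by (subst \<mu>N) (auto simp: covered_insert cov)
  show D: "Domain (break_at p \<mu>) = insert p (Domain \<mu>)"
    unfolding eq by (subst \<mu>N) auto
  show R: "Range (break_at p \<mu>) = insert p (Range \<mu>)"
    unfolding eq by (subst \<mu>N) auto
  show "breakpoints (break_at p \<mu>) = insert p (breakpoints \<mu>)"
    unfolding breakpoints_def D R by auto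
qed

lemma join_at_eq:
  assumes \<mu>: "viable_strands Z \<mu>" and xy: "(x, p) \<in> \<mu>" "(p, y) \<in> \<mu>"
  shows "join_at p \<mu> = insert (x, y) (\<mu> - {(x, p), (p, y)})"
proof -
  have k: "b = p \<longleftrightarrow> (a, b) = (x, p)" "a = p \<longleftrightarrow> (a, b) = (p, y)" if "(a, b) \<in> \<mu>" for a b
    using viable_strands_inj[OF \<mu> that xy(1)] viable_strands_inj[OF \<mu> that xy(2)] by auto
  have "{(a, b) \<in> \<mu>. a \<noteq> p \<and> b \<noteq> p} = \<mu> - {(x, p), (p, y)}" using k by blast
  moreover have "{(a, b). (a, p) \<in> \<mu> \<and> (p, b) \<in> \<mu>} = {(x, y)}" using k xy by blast
  ultimately show ?thesis unfolding join_at_def by simp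
qed

lemma join_at_props:
  assumes \<mu>: "viable_strands Z \<mu>" and p: "p \<in> breakpoints \<mu>"
  shows "viable_strands Z (join_at p \<mu>)" "covered (join_at p \<mu>) = covered \<mu>"
    "Domain (join_at p \<mu>) = Domain \<mu> - {p}" "Range (join_at p \<mu>) = Range \<mu> - {p}"
    "breakpoints (join_at p \<mu>) = breakpoints \<mu> - {p}"
proof -
  obtain x y where xy: "(x, p) \<in> \<mu>" "(p, y) \<in> \<mu>" using p unfolding breakpoints_def by auto
  define N where "N = \<mu> - {(x, p), (p, y)}"
  have eq: "join_at p \<mu> = insert (x, y) N" unfolding N_def by (rule join_at_eq[OF \<mu> xy])
  have \<mu>N: "\<mu> = insert (x, p) (insert (p, y) N)" unfolding N_def using xy by auto
  note l = viable_strands_less[OF \<mu> xy(1)] viable_strands_less[OF \<mu> xy(2)]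
  then have ne: "x \<noteq> p" "p \<noteq> y" "x \<noteq> y" by auto
  have u1: "a = x \<longleftrightarrow> b = p" if "(a, b) \<in> \<mu>" for a b
    using viable_strands_inj[OF \<mu> that xy(1)] .
  have u2: "a = p \<longleftrightarrow> b = y" if "(a, b) \<in> \<mu>" for a b
    using viable_strands_inj[OF \<mu> that xy(2)] .
  have inj: "inj_on fst N" "inj_on snd N"
    using \<mu> unfolding N_def viable_strands_def strand_diagram_def by (auto intro: inj_on_diff)
  have notin: "x \<notin> fst ` N" "y \<notin> snd ` N" "p \<notin> fst ` N" "p \<notin> snd ` N"
    using u1 u2 unfolding N_def by force+
  have "inj_on fst (join_at p \<mu>)"
    unfolding eq using notin by (intro inj_on_insertI inj(1)) auto
  moreover have "inj_on snd (join_at p \<mu>)"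
    unfolding eq using notin by (intro inj_on_insertI inj(2)) auto
  moreover have "join_at p \<mu> \<subseteq> points Z \<times> points Z"
    using \<mu> l unfolding eq N_def viable_strands_def strand_diagram_def by auto
  moreover have "\<forall>(a, b) \<in> join_at p \<mu>. point_le a b"
    using \<mu> l unfolding eq N_def viable_strands_def strand_diagram_def by (auto simp: point_le_def)
  ultimately have "strand_diagram Z (join_at p \<mu>)" unfolding strand_diagram_def by blast
  moreover have "no_horizontal (join_at p \<mu>)"
    using \<mu> ne unfolding eq N_def viable_strands_def no_horizontal_def by auto
  moreover have cov: "covers (x, y) e \<longleftrightarrow> covers (x, p) e \<or> covers (p, y) e" for e
    using l by (auto simp: covers_def)
  have "disjoint_strands (join_at p \<mu>)"
    unfolding disjoint_strands_def
  proof (intro ballI allI impI)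
    fix \<sigma> \<tau> e assume *: "\<sigma> \<in> join_at p \<mu>" "\<tau> \<in> join_at p \<mu>" "covers \<sigma> e" "covers \<tau> e"
    \<comment> \<open>The old strand over the step \<open>e\<close> is used as the witness; when
      \<open>\<sigma>\<close> is the joined strand it is one of the two pieces.\<close>
    have part: "\<exists>\<rho> \<in> \<mu>. covers \<rho> e \<and> (\<sigma> = \<rho> \<and> \<rho> \<notin> {(x, p), (p, y)} \<or> \<sigma> = (x, y) \<and> \<rho> \<in> {(x, p), (p, y)})"
      if "\<sigma> \<in> join_at p \<mu>" "covers \<sigma> e" for \<sigma>
    proof (cases "\<sigma> \<in> N")
      case True
      with that show ?thesis unfolding N_def by blast
    next
      case False
      with that have "\<sigma> = (x, y)" "covers (x, p) e \<or> covers (p, y) e" using cov unfolding eq by auto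
      with xy show ?thesis by blast
    qed
    obtain \<rho> where \<rho>: "\<rho> \<in> \<mu>" "covers \<rho> e"
      "\<sigma> = \<rho> \<and> \<rho> \<notin> {(x, p), (p, y)} \<or> \<sigma> = (x, y) \<and> \<rho> \<in> {(x, p), (p, y)}"
      using part[OF *(1,3)] by blast
    obtain \<rho>' where \<rho>': "\<rho>' \<in> \<mu>" "covers \<rho>' e"
      "\<tau> = \<rho>' \<and> \<rho>' \<notin> {(x, p), (p, y)} \<or> \<tau> = (x, y) \<and> \<rho>' \<in> {(x, p), (p, y)}"
      using part[OF *(2,4)] by blast
    have "\<rho> = \<rho>'" using viable_strands_unique[OF \<mu> \<rho>(1) \<rho>'(1) \<rho>(2) \<rho>'(2)] .
    with \<rho>(3) \<rho>'(3) show "\<sigma> = \<tau>" by auto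
  qed
  ultimately show "viable_strands Z (join_at p \<mu>)" unfolding viable_strands_def by blast
  show "covered (join_at p \<mu>) = covered \<mu>"
    unfolding eq by (subst \<mu>N) (auto simp: covered_insert cov)
  show D: "Domain (join_at p \<mu>) = Domain \<mu> - {p}"
    unfolding eq using notin(3) ne by (subst \<mu>N) (auto simp: Domain_fst)
  show R: "Range (join_at p \<mu>) = Range \<mu> - {p}"
    unfolding eq using notin(4) ne by (subst \<mu>N) (auto simp: Range_snd)
  show "breakpoints (join_at p \<mu>) = breakpoints \<mu> - {p}"
    unfolding breakpoints_def D R by auto
qed

lemma passed_break_at:
  assumes "viable_strands Z \<mu>" "p \<in> passed \<mu>"
  shows "passed (break_at p \<mu>) = passed \<mu> - {p}"
proof (rule set_eqI)
  show "q \<in> passed (break_at p \<mu>) \<longleftrightarrow> q \<in> passed \<mu> - {p}" for q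
    unfolding passed_iff[OF break_at_props(1)[OF assms]] Diff_iff passed_iff[OF assms(1)]
      break_at_props[OF assms] by blast
qed

text \<open>Resolving a crossing with the horizontal at \<open>p\<close> turns that horizontal into
  an end and a beginning of moving strands at \<open>p\<close>. The initial and final points of the
  whole term stay the same, so the conditions from \<open>s\<close> and \<open>t\<close> carry
  over.\<close>

lemma horizontals_break_at:
  assumes "viable_strands Z \<mu>" "p \<in> passed \<mu>"
  shows "U \<in> horizontals Z s (break_at p \<mu>) t \<longleftrightarrow> p \<notin> U \<and> insert p U \<in> horizontals Z s \<mu> t"
proof -
  have "p \<in> points Z" using passed_in_places[OF assms] places_subset_points by blast
  then show ?thesis
    using passed_notin[OF assms] unfolding horizontals_def break_at_props[OF assms] by auto
qed

lemma horizontals_join_at: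
  assumes "viable_strands Z \<mu>" "p \<in> breakpoints \<mu>" "U \<in> horizontals Z s \<mu> t"
  shows "insert p U \<in> horizontals Z s (join_at p \<mu>) t"
proof -
  have "p \<in> Domain \<mu>" "p \<in> Range \<mu>" using assms(2) unfolding breakpoints_def by auto
  moreover from this have "Domain \<mu> - {p} \<union> insert p U = Domain \<mu> \<union> U"
    "Range \<mu> - {p} \<union> insert p U = Range \<mu> \<union> U" by auto
  moreover have "p \<in> points Z"
    using \<open>p \<in> Domain \<mu>\<close> viable_strands_less[OF assms(1)] by blast
  ultimately show ?thesis
    using assms(3) unfolding horizontals_def join_at_props[OF assms(1,2)] by auto
qed

text \<open>Two strands without a common step never cross, so one of the two strands in a crossing is
  horizontal.\<close>

lemma crossings_viable:
  assumes \<mu>: "viable_strands Z \<mu>"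
  shows "crossings (\<mu> \<union> Id_on U) = {(\<sigma>, (p, p)) | \<sigma> p. \<sigma> \<in> \<mu> \<and> p \<in> U \<and> passes \<sigma> p}"
proof (intro set_eqI iffI)
  fix c assume C: "c \<in> crossings (\<mu> \<union> Id_on U)"
  obtain x y x' y' where c1: "c = ((x, y), (x', y'))" by (metis surj_pair)
  with C have c: "c = ((x, y), (x', y'))"
    "(x, y) \<in> \<mu> \<union> Id_on U" "(x', y') \<in> \<mu> \<union> Id_on U" "point_less x x'" "point_less y' y"
    unfolding crossings_def by simp_all
  have le: "fst x' = fst y'" "snd x' \<le> snd y'"
    using c(3) viable_strands_less[OF \<mu>, of x' y'] by auto
  have ne: "x \<noteq> y" using le c(4,5) by (auto simp: point_less_def)
  then have xy: "(x, y) \<in> \<mu>" using c(2) by auto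
  have "(x', y') \<notin> \<mu>"
  proof
    assume *: "(x', y') \<in> \<mu>"
    have "covers (x', y') x'" using viable_strands_less[OF \<mu> *] by (simp add: covers_def)
    moreover have "covers (x, y) x'" using le c(4,5) by (auto simp: covers_def point_less_def)
    ultimately have "(x, y) = (x', y')" using viable_strands_unique[OF \<mu> xy *] by blast
    with c(4) show False by (simp add: point_less_def)
  qed
  with c(3) have "x' = y'" "x' \<in> U" by auto
  with c(1,4,5) xy have "c = ((x, y), (x', x')) \<and> (x, y) \<in> \<mu> \<and> x' \<in> U \<and> passes (x, y) x'"
    by (simp add: passes_def)
  then show "c \<in> {(\<sigma>, (p, p)) | \<sigma> p. \<sigma> \<in> \<mu> \<and> p \<in> U \<and> passes \<sigma> p}" by blast
qed (auto simp: crossings_def passes_def)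

text \<open>Here \<open>through p\<close> is the unique strand running past \<open>p\<close>. One
  choice of \<open>through\<close> serves all \<open>U\<close>, which turns sums over crossings into
  sums over places.\<close>

lemma crossings_viable_image:
  assumes \<mu>: "viable_strands Z \<mu>"
  shows "\<exists>through. (\<forall>p \<in> passed \<mu>. through p \<in> \<mu> \<and> passes (through p) p) \<and>
    (\<forall>U. crossings (\<mu> \<union> Id_on U) = (\<lambda>p. (through p, (p, p))) ` (U \<inter> passed \<mu>))"
proof -
  have "\<forall>p \<in> passed \<mu>. \<exists>\<sigma>. \<sigma> \<in> \<mu> \<and> passes \<sigma> p" unfolding passed_def by blast
  then obtain through where th: "\<forall>p \<in> passed \<mu>. through p \<in> \<mu> \<and> passes (through p) p"
    using bchoice by meson
  have "\<sigma> \<in> \<mu> \<and> passes \<sigma> p \<longleftrightarrow> p \<in> passed \<mu> \<and> \<sigma> = through p" for \<sigma> p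
  proof
    assume *: "\<sigma> \<in> \<mu> \<and> passes \<sigma> p"
    then have p: "p \<in> passed \<mu>" unfolding passed_def by blast
    then have "\<sigma> = through p"
      using bspec[OF th p] * viable_strands_unique[OF \<mu>, of \<sigma> "through p" p]
        passes_covers(1)[of \<sigma> p] passes_covers(1)[of "through p" p] by blast
    with p show "p \<in> passed \<mu> \<and> \<sigma> = through p" ..
  qed (use th in auto)
  then have iff: "\<sigma> \<in> \<mu> \<and> p \<in> U \<and> passes \<sigma> p \<longleftrightarrow> p \<in> U \<inter> passed \<mu> \<and> \<sigma> = through p" for \<sigma> p U
    by (metis Int_iff)
  have "crossings (\<mu> \<union> Id_on U) = (\<lambda>p. (through p, (p, p))) ` (U \<inter> passed \<mu>)" for U
  proof (intro set_eqI iffI)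
    fix c assume "c \<in> crossings (\<mu> \<union> Id_on U)"
    then obtain \<sigma> p where c: "c = (\<sigma>, (p, p))" and "\<sigma> \<in> \<mu> \<and> p \<in> U \<and> passes \<sigma> p"
      unfolding crossings_viable[OF \<mu>] by blast
    then have "p \<in> U \<inter> passed \<mu> \<and> \<sigma> = through p" using iff by blast
    with c show "c \<in> (\<lambda>p. (through p, (p, p))) ` (U \<inter> passed \<mu>)" by (intro image_eqI[of _ _ p]) simp_all
  next
    fix c assume "c \<in> (\<lambda>p. (through p, (p, p))) ` (U \<inter> passed \<mu>)"
    then obtain p where c: "c = (through p, (p, p))" and "p \<in> U \<inter> passed \<mu>" by (elim imageE)
    then have *: "through p \<in> \<mu>" "p \<in> U" "passes (through p) p" using iff[of "through p" p U] by blast+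
    have "(through p, (p, p)) \<in> {(\<sigma>, (p, p)) | \<sigma> p. \<sigma> \<in> \<mu> \<and> p \<in> U \<and> passes \<sigma> p}"
      by (rule CollectI, rule exI[of _ "through p"], rule exI[of _ p], intro conjI refl *)
    then show "c \<in> crossings (\<mu> \<union> Id_on U)" unfolding c crossings_viable[OF \<mu>] .
  qed
  with th show ?thesis by (intro exI[of _ through] conjI) blast+
qed

lemma inv_count_viable:
  assumes "viable_strands Z \<mu>"
  shows "inv_count (\<mu> \<union> Id_on U) = card (U \<inter> passed \<mu>)"
proof -
  obtain through where
    "\<forall>U. crossings (\<mu> \<union> Id_on U) = (\<lambda>p. (through p, (p, p))) ` (U \<inter> passed \<mu>)"
    using crossings_viable_image[OF assms] by (elim exE conjE)
  then show ?thesis unfolding inv_count_def by (simp add: card_image inj_on_def)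
qed

section \<open>The boundary of a viable diagram\<close>

text \<open>Resolving the crossing at \<open>p\<close> removes exactly \<open>p\<close> from the
  passed places that carry a horizontal, so every resolution lowers the number of crossings by
  exactly one and contributes to the boundary.\<close>

lemma boundary_strands_viable:
  assumes \<mu>: "viable_strands Z \<mu>" and U: "U \<inter> (Domain \<mu> \<union> Range \<mu>) = {}"
  shows "boundary_strands (\<mu> \<union> Id_on U) =
    (\<Sum>p \<in> U \<inter> passed \<mu>. basic (break_at p \<mu> \<union> Id_on (U - {p})))"
proof -
  obtain through where th': "\<forall>p \<in> passed \<mu>. through p \<in> \<mu> \<and> passes (through p) p"
    and cr': "\<forall>U. crossings (\<mu> \<union> Id_on U) = (\<lambda>p. (through p, (p, p))) ` (U \<inter> passed \<mu>)"
    using crossings_viable_image[OF \<mu>] by (elim exE conjE)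
  note th = th'[rule_format] and cr = cr'[rule_format]
  have res: "resolve (through p, (p, p)) (\<mu> \<union> Id_on U) = break_at p \<mu> \<union> Id_on (U - {p})"
    if p: "p \<in> U \<inter> passed \<mu>" for p
  proof -
    obtain x y where xy: "through p = (x, y)" by (cases "through p")
    then have m: "(x, y) \<in> \<mu>" "passes (x, y) p" using th[of p] p by auto
    have "p \<notin> Domain \<mu>" using p passed_notin[OF \<mu>, of p] by blast
    then have "(p, p) \<notin> \<mu>" "(x, y) \<notin> Id_on U"
      using viable_strands_less[OF \<mu> m(1)] by auto
    then show ?thesis
      unfolding resolve_def xy break_at_eq[OF \<mu> m] by auto
  qed
  have inv: "inv_count (break_at p \<mu> \<union> Id_on (U - {p})) + 1 = inv_count (\<mu> \<union> Id_on U)"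
    if p: "p \<in> U \<inter> passed \<mu>" for p
  proof -
    have pm: "p \<in> passed \<mu>" using p by blast
    have "(U - {p}) \<inter> (passed \<mu> - {p}) = U \<inter> passed \<mu> - {p}" by blast
    moreover have "finite (U \<inter> passed \<mu>)" using finite_passed[OF \<mu>] by blast
    ultimately show ?thesis
      unfolding inv_count_viable[OF break_at_props(1)[OF \<mu> pm]] inv_count_viable[OF \<mu>]
        passed_break_at[OF \<mu> pm] using p card_Suc_Diff1 by fastforce
  qed
  let ?g = "\<lambda>p. (through p, (p, p))"
  have "{c \<in> crossings (\<mu> \<union> Id_on U). inv_count (resolve c (\<mu> \<union> Id_on U)) + 1 = inv_count (\<mu> \<union> Id_on U)}
      = ?g ` (U \<inter> passed \<mu>)"
    unfolding cr using res inv by auto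
  then have "boundary_strands (\<mu> \<union> Id_on U) =
      (\<Sum>c \<in> ?g ` (U \<inter> passed \<mu>). basic (resolve c (\<mu> \<union> Id_on U)))"
    unfolding boundary_strands_def by simp
  also have "\<dots> = (\<Sum>p \<in> U \<inter> passed \<mu>. basic (resolve (?g p) (\<mu> \<union> Id_on U)))"
    by (subst sum.reindex) (auto simp: inj_on_def)
  finally show ?thesis using res by simp
qed

text \<open>The sum over terms and then crossings is rearranged as a sum over places. A summand on
  the right is zero when no term of the diagram has a horizontal at \<open>p\<close>.\<close>

lemma boundary_diagram:
  assumes \<mu>: "viable_strands Z \<mu>"
  shows "boundary (diagram Z s \<mu> t) = (\<Sum>p \<in> passed \<mu>. diagram Z s (break_at p \<mu>) t)"
proof -
  let ?H = "horizontals Z s \<mu> t"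
  let ?b = "\<lambda>p U. basic (break_at p \<mu> \<union> Id_on (U - {p}))"
  have "boundary (diagram Z s \<mu> t) = (\<Sum>U \<in> ?H. boundary_strands (\<mu> \<union> Id_on U))"
    unfolding boundary_def keys_diagram by (simp add: sum.reindex[OF inj_on_horizontals])
  also have "\<dots> = (\<Sum>U \<in> ?H. \<Sum>p \<in> U \<inter> passed \<mu>. ?b p U)"
    by (intro sum.cong refl boundary_strands_viable[OF \<mu>]) (auto simp: horizontals_def)
  also have "\<dots> = (\<Sum>U \<in> ?H. \<Sum>p \<in> passed \<mu>. if p \<in> U then ?b p U else 0)"
  proof (rule sum.cong[OF refl])
    show "(\<Sum>p \<in> U \<inter> passed \<mu>. ?b p U) = (\<Sum>p \<in> passed \<mu>. if p \<in> U then ?b p U else 0)" for U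
      using sum.inter_restrict[OF finite_passed[OF \<mu>], of "\<lambda>p. ?b p U" U] by (simp add: Int_commute)
  qed
  also have "\<dots> = (\<Sum>p \<in> passed \<mu>. \<Sum>U \<in> ?H. if p \<in> U then ?b p U else 0)"
    by (rule sum.swap)
  also have "\<dots> = (\<Sum>p \<in> passed \<mu>. \<Sum>U \<in> {U \<in> ?H. p \<in> U}. ?b p U)"
    by (simp add: sum.inter_filter finite_horizontals)
  also have "\<dots> = (\<Sum>p \<in> passed \<mu>. diagram Z s (break_at p \<mu>) t)"
  proof (intro sum.cong refl)
    fix p assume p: "p \<in> passed \<mu>"
    \<comment> \<open>Deleting the horizontal at \<open>p\<close> matches the terms of
      \<open>\<mu>\<close> that have one with the terms of the broken diagram.\<close>
    show "(\<Sum>U \<in> {U \<in> ?H. p \<in> U}. ?b p U) = diagram Z s (break_at p \<mu>) t"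
      unfolding diagram_eq_sum
      by (rule sum.reindex_bij_witness[of _ "insert p" "\<lambda>U. U - {p}"])
        (auto simp: horizontals_break_at[OF \<mu> p] insert_absorb)
  qed
  finally show ?thesis .
qed

section \<open>The Maslov grading of a viable diagram\<close>

lemma hclass_Un_Id_on:
  assumes "finite \<mu>" "finite U" "U \<inter> Domain \<mu> = {}"
  shows "hclass (\<mu> \<union> Id_on U) = hclass \<mu>"
proof -
  have fin: "finite (Id_on U)" using assms(2) by (simp add: Id_on_eqI Id_on_def)
  have "hclass (\<mu> \<union> Id_on U) = hclass \<mu> + hclass (Id_on U)"
    unfolding hclass_def using assms fin by (intro sum.union_disjoint) auto
  also have "hclass (Id_on U) = 0"
    unfolding hclass_def by (intro sum.neutral) (auto simp: segment_class_def)
  finally show ?thesis by simp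
qed

lemma local_mult_Un:
  assumes "finite A" "finite B" "A \<inter> B = {}"
  shows "local_mult h (A \<union> B) = local_mult h A + local_mult h B"
  unfolding local_mult_def by (rule sum.union_disjoint[OF assms])

lemma local_mult_const:
  assumes "\<And>a. a \<in> A \<Longrightarrow> Poly_Mapping.lookup h (step_before a) = c \<and> Poly_Mapping.lookup h a = c"
  shows "local_mult h A = of_int c * of_nat (card A)"
proof -
  have "local_mult h A = (\<Sum>a \<in> A. of_int c)"
    unfolding local_mult_def step_after_def using assms by (intro sum.cong) auto
  then show ?thesis by simp
qed

text \<open>A horizontal at a passed place adds one crossing and average multiplicity one, which
  cancel; at any other place it adds neither. So the value does not depend on the term that
  \<open>maslov\<close> picks.\<close>

lemma maslov_diagram:
  assumes \<mu>: "viable_strands Z \<mu>" and nz: "diagram Z s \<mu> t \<noteq> 0"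
  shows "maslov Z (diagram Z s \<mu> t) = - local_mult (hclass \<mu>) (Domain \<mu> \<inter> places Z)"
proof -
  let ?D = "diagram Z s \<mu> t"
  define \<nu> where "\<nu> = (SOME \<nu>. \<nu> \<in> Poly_Mapping.keys ?D)"
  have "Poly_Mapping.keys ?D \<noteq> {}" using nz by simp
  then have "\<nu> \<in> Poly_Mapping.keys ?D" unfolding \<nu>_def by (simp add: some_in_eq)
  then obtain U where U: "U \<in> horizontals Z s \<mu> t" "\<nu> = \<mu> \<union> Id_on U"
    unfolding keys_diagram by auto
  then have U': "U \<subseteq> points Z" "U \<inter> Domain \<mu> = {}" "U \<inter> Range \<mu> = {}" unfolding horizontals_def by auto
  have fin: "finite U" using U'(1) finite_points finite_subset by blast
  have h: "Poly_Mapping.lookup (hclass \<mu>) e = of_bool (e \<in> covered \<mu>)" for e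
    using lookup_hclass_disjoint viable_strands_finite[OF \<mu>] \<mu> unfolding viable_strands_def by blast
  let ?h = "hclass \<mu>"
  have pl: "snd u \<noteq> 0" if "u \<in> places Z" for u using that unfolding places_def by auto
  have "local_mult ?h (U \<inter> places Z) =
      local_mult ?h ((U \<inter> passed \<mu>) \<union> (U \<inter> places Z - passed \<mu>))"
    using passed_in_places[OF \<mu>] by (intro arg_cong[of _ _ "local_mult ?h"]) auto
  also have "\<dots> = local_mult ?h (U \<inter> passed \<mu>) + local_mult ?h (U \<inter> places Z - passed \<mu>)"
    using fin by (intro local_mult_Un) auto
  also have "local_mult ?h (U \<inter> passed \<mu>) = of_int 1 * of_nat (card (U \<inter> passed \<mu>))"
    using passed_iff[OF \<mu>] by (intro local_mult_const) (simp add: h)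
  also have "local_mult ?h (U \<inter> places Z - passed \<mu>) = of_int 0 * of_nat (card (U \<inter> places Z - passed \<mu>))"
  proof (intro local_mult_const)
    \<comment> \<open>A covered step next to \<open>a\<close> would make \<open>a\<close> either
      passed or an endpoint of a moving strand.\<close>
    fix a assume "a \<in> U \<inter> places Z - passed \<mu>"
    then have "a \<notin> Domain \<mu>" "a \<notin> Range \<mu>" "a \<notin> passed \<mu>" "snd a \<noteq> 0" using U' pl by auto
    then show "Poly_Mapping.lookup ?h (step_before a) = 0 \<and> Poly_Mapping.lookup ?h a = 0"
      using Domain_iff_covered[OF \<mu>, of a] Range_iff_covered[OF \<mu>, of a] passed_iff[OF \<mu>, of a]
      unfolding h by auto
  qed
  finally have "local_mult ?h (U \<inter> places Z) = of_nat (card (U \<inter> passed \<mu>))" by simp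
  moreover have "local_mult ?h (Domain \<nu> \<inter> places Z) =
      local_mult ?h (Domain \<mu> \<inter> places Z) + local_mult ?h (U \<inter> places Z)"
  proof -
    have "Domain \<nu> \<inter> places Z = (Domain \<mu> \<inter> places Z) \<union> (U \<inter> places Z)" unfolding U(2) by auto
    then show ?thesis
      using U' fin finite_places by (simp, intro local_mult_Un) auto
  qed
  moreover have "hclass \<nu> = ?h"
    unfolding U(2) using hclass_Un_Id_on[OF viable_strands_finite[OF \<mu>] fin U'(2)] .
  moreover have "inv_count \<nu> = card (U \<inter> passed \<mu>)"
    unfolding U(2) by (rule inv_count_viable[OF \<mu>])
  ultimately show ?thesis unfolding maslov_def Let_def \<nu>_def[symmetric] by simp
qed

text \<open>Strands begin at places where the covered region starts, which depend only on
  \<open>h\<close>, and at breakpoints, each of average multiplicity one.\<close>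

lemma maslov_diagram_breakpoints:
  assumes \<mu>: "viable_strands Z \<mu>" and nz: "diagram Z s \<mu> t \<noteq> 0"
  shows "maslov Z (diagram Z s \<mu> t) =
    - local_mult (hclass \<mu>) {p \<in> places Z. p \<in> covered \<mu> \<and> step_before p \<notin> covered \<mu>}
    - of_nat (card (breakpoints \<mu>))"
proof -
  let ?A = "{p \<in> places Z. p \<in> covered \<mu> \<and> step_before p \<notin> covered \<mu>}"
  have h: "Poly_Mapping.lookup (hclass \<mu>) e = of_bool (e \<in> covered \<mu>)" for e
    using lookup_hclass_disjoint viable_strands_finite[OF \<mu>] \<mu> unfolding viable_strands_def by blast
  have pl: "snd u \<noteq> 0" if "u \<in> places Z" for u using that unfolding places_def by auto
  have bp: "breakpoints \<mu> \<subseteq> places Z" using breakpoints_in_places[OF \<mu>] by blast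
  have cov: "p \<in> covered \<mu>" "step_before p \<in> covered \<mu>" if "p \<in> breakpoints \<mu>" for p
    using breakpoints_covered[OF \<mu> that] by auto
  have "Domain \<mu> \<inter> places Z = ?A \<union> breakpoints \<mu>"
  proof (rule set_eqI)
    show "p \<in> Domain \<mu> \<inter> places Z \<longleftrightarrow> p \<in> ?A \<union> breakpoints \<mu>" for p
      using Domain_iff_covered[OF \<mu>, of p] pl[of p] bp cov[of p] by auto
  qed
  moreover have "?A \<inter> breakpoints \<mu> = {}" using cov by blast
  moreover have "finite ?A" "finite (breakpoints \<mu>)"
    using finite_places finite_subset[OF bp] by auto
  moreover have "local_mult (hclass \<mu>) (breakpoints \<mu>) = of_int 1 * of_nat (card (breakpoints \<mu>))"
    using cov by (intro local_mult_const) (simp add: h)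
  ultimately show ?thesis
    unfolding maslov_diagram[OF assms] by (simp add: local_mult_Un)
qed

section \<open>The summand of given H-data\<close>

text \<open>One term recovers the moving strands and both sets of pairs. Hence different diagrams
  have disjoint sets of terms, from which uniqueness of H-data and linear independence
  follow.\<close>

lemma diagram_key:
  assumes "no_horizontal \<mu>" "\<nu> \<in> Poly_Mapping.keys (diagram Z s \<mu> t)"
  shows "\<nu> - Id = \<mu>" "s = pair_of Z ` (Domain \<nu> \<inter> places Z)" "t = pair_of Z ` (Range \<nu> \<inter> places Z)"
proof -
  obtain U where U: "U \<in> horizontals Z s \<mu> t" "\<nu> = \<mu> \<union> Id_on U"
    using assms(2) unfolding keys_diagram by auto
  show "\<nu> - Id = \<mu>" using assms(1) unfolding U(2) no_horizontal_def by auto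
  have sec: "r = pair_of Z ` (S \<inter> places Z)" if S: "S \<in> sections Z r" for r S
  proof
    show "pair_of Z ` (S \<inter> places Z) \<subseteq> r" using S unfolding sections_def by auto
    show "r \<subseteq> pair_of Z ` (S \<inter> places Z)"
    proof
      fix P assume "P \<in> r"
      then have "card (S \<inter> pair_places Z P) = 1" using S unfolding sections_def by auto
      then have "S \<inter> pair_places Z P \<noteq> {}" by (metis card.empty zero_neq_one)
      then show "P \<in> pair_of Z ` (S \<inter> places Z)" unfolding pair_places_def by auto
    qed
  qed
  have "Domain \<nu> = Domain \<mu> \<union> U" "Range \<nu> = Range \<mu> \<union> U" unfolding U(2) by auto
  then show "s = pair_of Z ` (Domain \<nu> \<inter> places Z)" "t = pair_of Z ` (Range \<nu> \<inter> places Z)"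
    using sec[of "Domain \<nu>" s] sec[of "Range \<nu>" t] U(1) unfolding horizontals_def by auto
qed

lemma diagrams_common_key:
  assumes "D \<in> diagrams Z H" "D' \<in> diagrams Z H'"
    and "\<nu> \<in> Poly_Mapping.keys D" "\<nu> \<in> Poly_Mapping.keys D'"
  shows "D = D'" "H = H'"
proof -
  obtain h s t where H: "H = (h, s, t)" by (metis prod_cases3)
  obtain h' s' t' where H': "H' = (h', s', t')" by (metis prod_cases3)
  obtain \<mu> where \<mu>: "no_horizontal \<mu>" "D = diagram Z s \<mu> t" "h = hclass \<mu>"
    using assms(1) unfolding H diagrams_def by auto
  obtain \<mu>' where \<mu>': "no_horizontal \<mu>'" "D' = diagram Z s' \<mu>' t'" "h' = hclass \<mu>'"
    using assms(2) unfolding H' diagrams_def by auto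
  note k = diagram_key[OF \<mu>(1) assms(3)[unfolded \<mu>(2)]]
  note k' = diagram_key[OF \<mu>'(1) assms(4)[unfolded \<mu>'(2)]]
  have "\<mu> = \<mu>'" "s = s'" "t = t'" using k(1) k'(1) k(2,3) k'(2,3) by simp_all
  then show "D = D'" "H = H'" using \<mu> \<mu>' H H' by auto
qed

lemma diagrams_keys_nonempty: "D \<in> diagrams Z H \<Longrightarrow> Poly_Mapping.keys D \<noteq> {}"
  unfolding diagrams_def by auto

lemma hdata_of_diagram: "D \<in> diagrams Z H \<Longrightarrow> hdata_of Z D = H"
  unfolding hdata_of_def using diagrams_common_key(2) diagrams_keys_nonempty by (metis equals0I the_equality)

lemma keys_scale_chain: "Poly_Mapping.keys (scale_chain c x) \<subseteq> Poly_Mapping.keys x"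
  by (auto simp: in_keys_iff lookup_scale_chain)

lemma keys_span:
  assumes "x \<in> chain.span S"
  shows "Poly_Mapping.keys x \<subseteq> \<Union> (Poly_Mapping.keys ` S)"
  using assms
proof (induction rule: chain.span_induct_alt)
  case (step c y z)
  have "Poly_Mapping.keys (scale_chain c y + z) \<subseteq>
      Poly_Mapping.keys (scale_chain c y) \<union> Poly_Mapping.keys z"
    by (rule keys_add)
  also have "\<dots> \<subseteq> \<Union> (Poly_Mapping.keys ` S)"
  proof (rule Un_least)
    show "Poly_Mapping.keys (scale_chain c y) \<subseteq> \<Union> (Poly_Mapping.keys ` S)"
      using keys_scale_chain[of c y] step(1) by blast
  qed (rule step(2))
  finally show ?case .
qed simp

text \<open>A term of \<open>D\<close> must occur in some generator, and a diagram sharing a term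
  with \<open>D\<close> is \<open>D\<close>.\<close>

lemma diagram_in_span:
  assumes "D \<in> diagrams Z H" "D \<in> chain.span S" "S \<subseteq> all_diagrams Z"
  shows "D \<in> S"
proof -
  obtain \<nu> where \<nu>: "\<nu> \<in> Poly_Mapping.keys D" using diagrams_keys_nonempty[OF assms(1)] by blast
  then obtain D' where D': "D' \<in> S" "\<nu> \<in> Poly_Mapping.keys D'" using keys_span[OF assms(2)] by blast
  then obtain H' where "D' \<in> diagrams Z H'" using assms(3) unfolding all_diagrams_def by blast
  then have "D = D'" using diagrams_common_key(1)[OF assms(1) _ \<nu> D'(2)] by blast
  then show ?thesis using D' by simp
qed

text \<open>A term of \<open>v\<close> occurs in no other diagram, so evaluating a vanishing
  combination there isolates the coefficient of \<open>v\<close>.\<close>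

lemma independent_diagrams: "chain.independent (all_diagrams Z)"
proof
  assume "chain.dependent (all_diagrams Z)"
  then obtain A u v where A: "finite A" "A \<subseteq> all_diagrams Z" "(\<Sum>D \<in> A. scale_chain (u D) D) = 0"
    and v: "v \<in> A" "u v \<noteq> 0"
    unfolding chain.dependent_explicit by auto
  obtain H where H: "v \<in> diagrams Z H" using A(2) v(1) unfolding all_diagrams_def by blast
  obtain \<nu> where \<nu>: "\<nu> \<in> Poly_Mapping.keys v" using diagrams_keys_nonempty[OF H] by blast
  have "Poly_Mapping.lookup D \<nu> = 0" if "D \<in> A" "D \<noteq> v" for D
  proof (rule ccontr)
    assume "Poly_Mapping.lookup D \<nu> \<noteq> 0"
    then have "\<nu> \<in> Poly_Mapping.keys D" by (simp add: in_keys_iff)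
    moreover obtain H' where "D \<in> diagrams Z H'" using A(2) \<open>D \<in> A\<close> unfolding all_diagrams_def by blast
    ultimately show False using diagrams_common_key(1)[OF _ H _ \<nu>] \<open>D \<noteq> v\<close> by blast
  qed
  then have "(\<Sum>D \<in> A. Poly_Mapping.lookup (scale_chain (u D) D) \<nu>) =
      (\<Sum>D \<in> {v}. Poly_Mapping.lookup (scale_chain (u D) D) \<nu>)"
    using A(1) v(1) by (intro sum.mono_neutral_right) (auto simp: lookup_scale_chain)
  moreover have "(\<Sum>D \<in> A. Poly_Mapping.lookup (scale_chain (u D) D) \<nu>) = 0"
    using arg_cong[OF A(3), of "\<lambda>x. Poly_Mapping.lookup x \<nu>"] by (simp add: lookup_sum)
  ultimately show False using v(2) \<nu> by (simp add: lookup_scale_chain in_keys_iff)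
qed

section \<open>Matched pairs and sections\<close>

lemma pair_places_partner:
  assumes "is_arc_diagram Z" "p \<in> places Z"
  obtains q where "pair_places Z (pair_of Z p) = {p, q}" "q \<noteq> p" "q \<in> places Z" "pair_of Z q = pair_of Z p"
proof -
  have "card (pair_places Z (pair_of Z p)) = 2" using assms unfolding is_arc_diagram_def by blast
  then obtain a b where ab: "pair_places Z (pair_of Z p) = {a, b}" "a \<noteq> b" by (meson card_2_iff)
  have "p \<in> pair_places Z (pair_of Z p)" using assms(2) unfolding pair_places_def by simp
  with ab have "p = a \<or> p = b" by simp
  then have "\<exists>q. pair_places Z (pair_of Z p) = {p, q} \<and> q \<noteq> p"
  proof
    assume "p = a"
    with ab show ?thesis by (intro exI[of _ b]) auto
  next
    assume "p = b"
    with ab show ?thesis by (intro exI[of _ a]) auto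
  qed
  then obtain q where q: "pair_places Z (pair_of Z p) = {p, q}" "q \<noteq> p" by blast
  then have "q \<in> pair_places Z (pair_of Z p)" by simp
  with q that show thesis unfolding pair_places_def by blast
qed

lemma sections_pair_unique:
  assumes "S \<in> sections Z s" "p \<in> S" "q \<in> S" "p \<in> places Z" "q \<in> places Z" "pair_of Z p = pair_of Z q"
  shows "p = q"
proof -
  let ?A = "S \<inter> pair_places Z (pair_of Z p)"
  have "card ?A = 1" using assms unfolding sections_def by auto
  moreover have "p \<in> ?A" "q \<in> ?A" using assms unfolding pair_places_def by auto
  ultimately show ?thesis by (metis card_1_singletonE singletonD)
qed

text \<open>Covers both cases: a section that already uses \<open>p\<close> is unchanged, and one
  that uses \<open>q\<close> is switched to \<open>p\<close>.\<close>

lemma sections_move: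
  assumes "S \<in> sections Z s" "P \<in> s" "pair_places Z P = {p, q}" "p \<noteq> q"
  shows "insert p (S - {q}) \<in> sections Z s"
proof -
  have pq: "x \<in> places Z \<and> pair_of Z x = P" if "x \<in> {p, q}" for x
    using that assms(3) unfolding pair_places_def by blast
  have "insert p (S - {q}) \<inter> pair_places Z Q = S \<inter> pair_places Z Q" if "Q \<noteq> P" for Q
    using that pq unfolding pair_places_def by auto
  moreover have "insert p (S - {q}) \<inter> pair_places Z P = {p}" using assms(3,4) by auto
  ultimately have "card (insert p (S - {q}) \<inter> pair_places Z Q) = 1" if "Q \<in> s" for Q
    using assms(1) that unfolding sections_def by (cases "Q = P") auto
  moreover have "p \<in> points Z" using pq places_subset_points by blast
  ultimately show ?thesis using assms(1,2) pq unfolding sections_def by auto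
qed

section \<open>The breakpoint sets of fixed viable H-data\<close>

locale viable_hdata =
  fixes Z :: arc_diagram and h :: homology_class and s t :: "nat set"
  assumes arc: "is_arc_diagram Z" and hdata: "is_hdata Z (h, s, t)" and viable_h: "viable Z h"
    and inhabited: "diagrams Z (h, s, t) \<noteq> {}"
begin

definition moving :: "strands set" where
  "moving = {\<mu>. viable_strands Z \<mu> \<and> hclass \<mu> = h \<and> diagram Z s \<mu> t \<noteq> 0}"

definition K :: "step set" where
  "K = {e. Poly_Mapping.lookup h e \<noteq> 0}"

text \<open>The vertices of the complex are taken from the diagrams themselves rather than from a
  condition on \<open>h\<close>; the local conditions that they satisfy are derived in
  \<open>M_props\<close>.\<close>

definition M :: "point set" where
  "M = {p. \<exists>\<mu> \<in> moving. breakpoints \<mu> = {p}}"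

lemma movingD:
  assumes "\<mu> \<in> moving"
  shows "viable_strands Z \<mu>" "hclass \<mu> = h" "diagram Z s \<mu> t \<noteq> 0" "covered \<mu> = K"
proof -
  show v: "viable_strands Z \<mu>" and h: "hclass \<mu> = h" and "diagram Z s \<mu> t \<noteq> 0"
    using assms unfolding moving_def by auto
  have "Poly_Mapping.lookup h e = of_bool (e \<in> covered \<mu>)" for e
    using lookup_hclass_disjoint[OF viable_strands_finite[OF v]] v h unfolding viable_strands_def by blast
  then show "covered \<mu> = K" unfolding K_def by auto
qed

lemma diagrams_eq: "diagrams Z (h, s, t) = (\<lambda>\<mu>. diagram Z s \<mu> t) ` moving"
proof (intro set_eqI iffI)
  fix D assume "D \<in> diagrams Z (h, s, t)"
  then obtain \<mu> where \<mu>: "D \<noteq> 0" "strand_diagram Z \<mu>" "no_horizontal \<mu>" "D = diagram Z s \<mu> t" "h = hclass \<mu>"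
    unfolding diagrams_def by auto
  then have "\<mu> \<in> moving"
    using viable_disjoint_strands[OF \<mu>(2)] viable_h unfolding moving_def viable_strands_def by auto
  with \<mu>(4) show "D \<in> (\<lambda>\<mu>. diagram Z s \<mu> t) ` moving" by blast
next
  fix D assume "D \<in> (\<lambda>\<mu>. diagram Z s \<mu> t) ` moving"
  then obtain \<mu> where "\<mu> \<in> moving" "D = diagram Z s \<mu> t" by blast
  then show "D \<in> diagrams Z (h, s, t)"
    using hdata movingD[of \<mu>] unfolding diagrams_def viable_strands_def by auto
qed

lemma movingI:
  assumes "\<mu> \<in> moving" "viable_strands Z \<mu>'" "covered \<mu>' = K" "horizontals Z s \<mu>' t \<noteq> {}"
  shows "\<mu>' \<in> moving"
proof -
  have "hclass \<mu>' = hclass \<mu>"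
    using assms(2,3) movingD[OF assms(1)] viable_strands_finite
    unfolding viable_strands_def by (intro hclass_eq_if_covered_eq) auto
  then show ?thesis
    using assms movingD[OF assms(1)] unfolding moving_def diagram_nonzero_iff by simp
qed

lemma moving_eqI: "\<mu> \<in> moving \<Longrightarrow> \<mu>' \<in> moving \<Longrightarrow> breakpoints \<mu> = breakpoints \<mu>' \<Longrightarrow> \<mu> = \<mu>'"
  using viable_strands_eqI movingD by metis

lemma moving_horizontals: "\<mu> \<in> moving \<Longrightarrow> \<exists>U. U \<in> horizontals Z s \<mu> t"
  using movingD(3) diagram_nonzero_iff by (metis all_not_in_conv)

lemma join_moving:
  assumes "\<mu> \<in> moving" "p \<in> breakpoints \<mu>"
  shows "join_at p \<mu> \<in> moving"
proof -
  note v = movingD(1)[OF assms(1)]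
  obtain U where "U \<in> horizontals Z s \<mu> t" using moving_horizontals[OF assms(1)] by blast
  then have "horizontals Z s (join_at p \<mu>) t \<noteq> {}"
    using horizontals_join_at[OF v assms(2)] by blast
  then show ?thesis
    using movingI[OF assms(1)] join_at_props(1,2)[OF v assms(2)] movingD(4)[OF assms(1)] by simp
qed

lemma break_moving_iff:
  assumes "\<mu> \<in> moving" "p \<in> passed \<mu>"
  shows "break_at p \<mu> \<in> moving \<longleftrightarrow> (\<exists>U \<in> horizontals Z s \<mu> t. p \<in> U)"
proof -
  note v = movingD(1)[OF assms(1)]
  have "break_at p \<mu> \<in> moving \<longleftrightarrow> horizontals Z s (break_at p \<mu>) t \<noteq> {}"
    using movingI[OF assms(1)] break_at_props(1,2)[OF v assms(2)] movingD(4)[OF assms(1)]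
      moving_horizontals by blast
  also have "\<dots> \<longleftrightarrow> (\<exists>U. p \<notin> U \<and> insert p U \<in> horizontals Z s \<mu> t)"
    using horizontals_break_at[OF v assms(2)] by blast
  also have "\<dots> \<longleftrightarrow> (\<exists>U \<in> horizontals Z s \<mu> t. p \<in> U)"
    by (metis Diff_iff insertI1 mk_disjoint_insert)
  finally show ?thesis .
qed

text \<open>The initial points of any term form a section, and so do its final points; a section
  meets each pair at most once.\<close>

lemma moving_pair_unique:
  assumes "\<mu> \<in> moving" "p \<in> places Z" "q \<in> places Z" "pair_of Z p = pair_of Z q"
    and "p \<in> Domain \<mu> \<and> q \<in> Domain \<mu> \<or> p \<in> Range \<mu> \<and> q \<in> Range \<mu>"
  shows "p = q"
proof -
  obtain U where "U \<in> horizontals Z s \<mu> t" using moving_horizontals[OF assms(1)] by blast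
  then have "Domain \<mu> \<union> U \<in> sections Z s" "Range \<mu> \<union> U \<in> sections Z t" unfolding horizontals_def by auto
  then show ?thesis
    using sections_pair_unique[of _ Z _ p q] assms(2-5) by blast
qed

lemma Domain_pair_in_s:
  assumes "\<mu> \<in> moving" "p \<in> places Z" "p \<in> Domain \<mu>"
  shows "pair_of Z p \<in> s"
proof -
  obtain U where "U \<in> horizontals Z s \<mu> t" using moving_horizontals[OF assms(1)] by blast
  then have "Domain \<mu> \<union> U \<in> sections Z s" unfolding horizontals_def by auto
  then show ?thesis using assms(2,3) unfolding sections_def by blast
qed

lemma Range_pair_in_t:
  assumes "\<mu> \<in> moving" "p \<in> places Z" "p \<in> Range \<mu>"
  shows "pair_of Z p \<in> t"
proof -
  obtain U where "U \<in> horizontals Z s \<mu> t" using moving_horizontals[OF assms(1)] by blast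
  then have "Range \<mu> \<union> U \<in> sections Z t" unfolding horizontals_def by auto
  then show ?thesis using assms(2,3) unfolding sections_def by blast
qed

text \<open>The horizontal strand at the pair of \<open>p\<close> may be moved from \<open>q\<close> to \<open>p\<close>.\<close>

lemma break_moving:
  assumes \<mu>: "\<mu> \<in> moving" and p: "p \<in> passed \<mu>" and P: "pair_of Z p \<in> s"
    and q: "pair_places Z (pair_of Z p) = {p, q}" "q \<noteq> p" "q \<notin> Domain \<mu>" "q \<notin> Range \<mu>"
  shows "break_at p \<mu> \<in> moving"
proof -
  note v = movingD(1)[OF \<mu>]
  obtain U where U: "U \<in> horizontals Z s \<mu> t" using moving_horizontals[OF \<mu>] by blast
  then have S: "Domain \<mu> \<union> U \<in> sections Z s" "Range \<mu> \<union> U \<in> sections Z t"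
    "U \<subseteq> points Z - (Domain \<mu> \<union> Range \<mu>)" unfolding horizontals_def by auto
  have np: "p \<notin> Domain \<mu>" "p \<notin> Range \<mu>" using passed_notin[OF v p] by auto
  have pl: "x \<in> places Z \<and> pair_of Z x = pair_of Z p" if "x \<in> {p, q}" for x
    using that q(1) unfolding pair_places_def by blast
  \<comment> \<open>One place of the pair is occupied initially, and by a horizontal since no moving
    strand starts at either place. The horizontal is there at the end too, so the pair lies in
    \<open>t\<close>.\<close>
  have "card ((Domain \<mu> \<union> U) \<inter> {p, q}) = 1" using S(1) P q(1) unfolding sections_def by fastforce
  then have "(Domain \<mu> \<union> U) \<inter> {p, q} \<noteq> {}" by (metis card.empty zero_neq_one)
  then obtain x where "x \<in> U" "x \<in> {p, q}" using np q(3) by blast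
  moreover from this have "pair_of Z x \<in> t" using S(2) pl[of x] unfolding sections_def by blast
  ultimately have "pair_of Z p \<in> t" using pl[of x] by simp
  let ?U = "insert p (U - {q})"
  have eq: "Domain \<mu> \<union> ?U = insert p (Domain \<mu> \<union> U - {q})" "Range \<mu> \<union> ?U = insert p (Range \<mu> \<union> U - {q})"
    using q(3,4) by auto
  have pq: "p \<noteq> q" using q(2) by simp
  have "p \<in> points Z" using pl[of p] places_subset_points by blast
  then have "?U \<subseteq> points Z - (Domain \<mu> \<union> Range \<mu>)" using S(3) np by blast
  then have "?U \<in> horizontals Z s \<mu> t"
    using sections_move[OF S(1) P q(1) pq] sections_move[OF S(2) \<open>pair_of Z p \<in> t\<close> q(1) pq]
    unfolding horizontals_def mem_Collect_eq eq by blast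
  then show ?thesis using break_moving_iff[OF \<mu> p] by blast
qed

lemma place_nonzero: "p \<in> places Z \<Longrightarrow> snd p \<noteq> 0"
  unfolding places_def by auto

text \<open>The surplus breakpoints are joined one at a time.\<close>

lemma breakpoints_down_closed:
  assumes "\<mu> \<in> moving" "B \<subseteq> breakpoints \<mu>"
  shows "\<exists>\<mu>' \<in> moving. breakpoints \<mu>' = B"
proof -
  have fin: "finite (breakpoints \<mu>)"
    using breakpoints_in_places[OF movingD(1)[OF assms(1)]] finite_places by (meson finite_subset subsetI)
  have "\<exists>\<mu>' \<in> moving. breakpoints \<mu>' = breakpoints \<mu> - A" if "finite A" "A \<subseteq> breakpoints \<mu>" for A
    using that
  proof (induction A)
    case empty
    then show ?case using assms(1) by auto
  next
    case (insert p A)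
    then obtain \<mu>' where \<mu>': "\<mu>' \<in> moving" "breakpoints \<mu>' = breakpoints \<mu> - A" by auto
    then have p: "p \<in> breakpoints \<mu>'" using insert by auto
    have "breakpoints (join_at p \<mu>') = breakpoints \<mu> - insert p A"
      using join_at_props(5)[OF movingD(1)[OF \<mu>'(1)] p] \<mu>'(2) by auto
    then show ?case using join_moving[OF \<mu>'(1) p] by blast
  qed
  from this[of "breakpoints \<mu> - B"] fin assms(2) show ?thesis by (simp add: double_diff)
qed

lemma M_props:
  assumes "p \<in> M"
  shows "p \<in> places Z" "p \<in> K" "step_before p \<in> K" "pair_of Z p \<in> s" "pair_of Z p \<in> t"
proof -
  obtain \<mu> where \<mu>: "\<mu> \<in> moving" "breakpoints \<mu> = {p}" using assms unfolding M_def by blast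
  then have p: "p \<in> breakpoints \<mu>" by simp
  note v = movingD(1)[OF \<mu>(1)]
  show pl: "p \<in> places Z" by (rule breakpoints_in_places[OF v p])
  show "p \<in> K" "step_before p \<in> K" using breakpoints_covered[OF v p] movingD(4)[OF \<mu>(1)] by auto
  show "pair_of Z p \<in> s" "pair_of Z p \<in> t"
    using Domain_pair_in_s[OF \<mu>(1) pl] Range_pair_in_t[OF \<mu>(1) pl] p unfolding breakpoints_def by auto
qed

sublocale partial_transversals M "pair_of Z"
proof
  show "finite M" using M_props(1) finite_places by (meson finite_subset subsetI)
qed

text \<open>Two breakpoints in one pair would be two initial points in that pair.\<close>

lemma breakpoints_indep:
  assumes "\<mu> \<in> moving"
  shows "indep (breakpoints \<mu>)"
proof -
  note pl = breakpoints_in_places[OF movingD(1)[OF assms]]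
  have "p \<in> M" if "p \<in> breakpoints \<mu>" for p
    using breakpoints_down_closed[OF assms, of "{p}"] that unfolding M_def by auto
  moreover have "inj_on (pair_of Z) (breakpoints \<mu>)"
  proof (rule inj_onI)
    fix p q assume "p \<in> breakpoints \<mu>" "q \<in> breakpoints \<mu>" "pair_of Z p = pair_of Z q"
    then show "p = q"
      using moving_pair_unique[OF assms, of p q] pl unfolding breakpoints_def by blast
  qed
  ultimately show ?thesis unfolding indep_def by blast
qed

text \<open>Breakpoints are created one at a time. Breaking at \<open>p\<close> needs a horizontal
  that can be placed at \<open>p\<close>, so no moving strand may start or end at the partner
  \<open>q\<close>.\<close>

lemma indep_breakpoints:
  assumes "indep B"
  shows "\<exists>\<mu> \<in> moving. breakpoints \<mu> = B"
  using finite_indep[OF assms] assms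
proof (induction B)
  case empty
  obtain \<mu> where "\<mu> \<in> moving" using inhabited diagrams_eq by auto
  then show ?case using breakpoints_down_closed by blast
next
  case (insert p B)
  then have "indep B" unfolding indep_def by (auto intro: inj_on_subset)
  then obtain \<mu> where \<mu>: "\<mu> \<in> moving" "breakpoints \<mu> = B" using insert by blast
  note v = movingD(1)[OF \<mu>(1)] and cov = movingD(4)[OF \<mu>(1)]
  have pM: "p \<in> M" using insert.prems indep_subset by blast
  note p = M_props[OF pM]
  \<comment> \<open>In \<open>\<mu>p\<close> the moving strands use \<open>p\<close>, so none starts
    or ends at \<open>q\<close>. Away from breakpoints the starts and ends depend only on
    \<open>K\<close>, and \<open>q\<close> is not a breakpoint of \<open>\<mu>\<close>; so the same
    holds in \<open>\<mu>\<close>.\<close>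
  obtain \<mu>p where \<mu>p: "\<mu>p \<in> moving" "breakpoints \<mu>p = {p}" using pM unfolding M_def by blast
  note vp = movingD(1)[OF \<mu>p(1)] and covp = movingD(4)[OF \<mu>p(1)]
  have pp: "p \<in> Domain \<mu>p" "p \<in> Range \<mu>p" using \<mu>p(2) unfolding breakpoints_def by auto
  have pas: "p \<in> passed \<mu>"
    using passed_iff[OF v, of p] p cov \<mu>(2) insert.hyps place_nonzero by blast
  obtain q where q: "pair_places Z (pair_of Z p) = {p, q}" "q \<noteq> p" "q \<in> places Z" "pair_of Z q = pair_of Z p"
    using pair_places_partner[OF arc p(1)] .
  have qB: "q \<notin> breakpoints \<mu>"
    using indep_eq[OF insert.prems, of q p] q \<mu>(2) by blast
  have qp: "q \<notin> Domain \<mu>p" "q \<notin> Range \<mu>p"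
    using moving_pair_unique[OF \<mu>p(1) p(1) q(3)] q(2,4) pp by auto
  have "q \<notin> Domain \<mu>"
    using qp(1) qB Domain_iff_covered[OF v, of q] Domain_iff_covered[OF vp, of q] cov covp by blast
  moreover have "q \<notin> Range \<mu>"
    using qp(2) qB Range_iff_covered[OF v, of q] Range_iff_covered[OF vp, of q] cov covp by blast
  ultimately have "break_at p \<mu> \<in> moving" using break_moving[OF \<mu>(1) pas p(4) q(1,2)] by blast
  moreover have "breakpoints (break_at p \<mu>) = insert p B" using break_at_props(5)[OF v pas] \<mu>(2) by simp
  ultimately show ?case by blast
qed

definition strands_at :: "point set \<Rightarrow> strands" where
  "strands_at B = (THE \<mu>. \<mu> \<in> moving \<and> breakpoints \<mu> = B)"

definition diag :: "point set \<Rightarrow> chain" where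
  "diag B = diagram Z s (strands_at B) t"

lemma strands_at_breakpoints: "\<mu> \<in> moving \<Longrightarrow> strands_at (breakpoints \<mu>) = \<mu>"
  unfolding strands_at_def
proof (rule the_equality)
  fix \<mu>' assume "\<mu> \<in> moving" "\<mu>' \<in> moving \<and> breakpoints \<mu>' = breakpoints \<mu>"
  then show "\<mu>' = \<mu>" using moving_eqI by blast
qed simp

lemma strands_at:
  assumes "indep B"
  shows "strands_at B \<in> moving" "breakpoints (strands_at B) = B"
  using indep_breakpoints[OF assms] strands_at_breakpoints by auto

lemma diag_in: "indep B \<Longrightarrow> diag B \<in> diagrams Z (h, s, t)"
  unfolding diag_def diagrams_eq using strands_at(1) by blast

lemma diagrams_eq_diag: "diagrams Z (h, s, t) = diag ` Collect indep"
proof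
  show "diag ` Collect indep \<subseteq> diagrams Z (h, s, t)" using diag_in by blast
  show "diagrams Z (h, s, t) \<subseteq> diag ` Collect indep"
  proof
    fix D assume "D \<in> diagrams Z (h, s, t)"
    then obtain \<mu> where "\<mu> \<in> moving" "D = diagram Z s \<mu> t" unfolding diagrams_eq by blast
    then have "D = diag (breakpoints \<mu>)" "indep (breakpoints \<mu>)"
      unfolding diag_def by (simp_all add: strands_at_breakpoints breakpoints_indep)
    then show "D \<in> diag ` Collect indep" by blast
  qed
qed

lemma break_moving_ext:
  assumes "\<mu> \<in> moving" "p \<in> passed \<mu>"
  shows "break_at p \<mu> \<in> moving \<longleftrightarrow> p \<in> ext (breakpoints \<mu>)"
proof
  note v = movingD(1)[OF assms(1)]
  note bp = break_at_props[OF v assms(2)]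
  have pB: "p \<notin> breakpoints \<mu>" using passed_iff[OF v] assms(2) by blast
  {
    assume "break_at p \<mu> \<in> moving"
    then have "indep (insert p (breakpoints \<mu>))" using breakpoints_indep bp(5) by metis
    then show "p \<in> ext (breakpoints \<mu>)" using pB unfolding indep_def ext_def by auto
  }
  assume "p \<in> ext (breakpoints \<mu>)"
  then have ind: "indep (insert p (breakpoints \<mu>))" using indep_insert breakpoints_indep[OF assms(1)] by blast
  note sa = strands_at[OF ind]
  have "break_at p \<mu> = strands_at (insert p (breakpoints \<mu>))"
    using viable_strands_eqI[OF bp(1) movingD(1)[OF sa(1)]] bp(2,5) sa(2) movingD(4) assms(1) sa(1) by metis
  then show "break_at p \<mu> \<in> moving" using sa(1) by simp
qed

lemma ext_passed:
  assumes "\<mu> \<in> moving" "p \<in> ext (breakpoints \<mu>)"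
  shows "p \<in> passed \<mu>"
proof -
  have pM: "p \<in> M" using assms(2) unfolding ext_def by blast
  note p = M_props[OF pM]
  show ?thesis
    using passed_iff[OF movingD(1)[OF assms(1)], of p] p movingD(4)[OF assms(1)]
      ext_notin[OF assms(2)] place_nonzero[OF p(1)] by blast
qed

text \<open>Breaking at a passed place outside \<open>ext B\<close> leaves no admissible choice of
  horizontals, so these summands of the boundary vanish.\<close>

lemma boundary_diag:
  assumes "indep B"
  shows "boundary (diag B) = (\<Sum>p \<in> ext B. diag (insert p B))"
proof -
  let ?\<mu> = "strands_at B"
  note sa = strands_at[OF assms]
  note v = movingD(1)[OF sa(1)]
  have "boundary (diag B) = (\<Sum>p \<in> passed ?\<mu>. diagram Z s (break_at p ?\<mu>) t)"
    unfolding diag_def by (rule boundary_diagram[OF v])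
  also have "\<dots> = (\<Sum>p \<in> ext B. diagram Z s (break_at p ?\<mu>) t)"
  proof (rule sum.mono_neutral_right[OF finite_passed[OF v]])
    show "ext B \<subseteq> passed ?\<mu>" using ext_passed[OF sa(1)] sa(2) by auto
    show "\<forall>p \<in> passed ?\<mu> - ext B. diagram Z s (break_at p ?\<mu>) t = 0"
    proof
      fix p assume p: "p \<in> passed ?\<mu> - ext B"
      then have "break_at p ?\<mu> \<notin> moving" using break_moving_ext[OF sa(1)] sa(2) by auto
      then have "horizontals Z s (break_at p ?\<mu>) t = {}"
        using movingI[OF sa(1)] break_at_props(1,2)[OF v] movingD(4)[OF sa(1)] p by blast
      then show "diagram Z s (break_at p ?\<mu>) t = 0" using diagram_nonzero_iff by blast
    qed
  qed
  also have "\<dots> = (\<Sum>p \<in> ext B. diag (insert p B))"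
  proof (rule sum.cong[OF refl])
    fix p assume p: "p \<in> ext B"
    then have "p \<in> passed ?\<mu>" using ext_passed[OF sa(1)] sa(2) by auto
    then have "break_at p ?\<mu> \<in> moving" "breakpoints (break_at p ?\<mu>) = insert p B"
      using break_moving_ext[OF sa(1)] break_at_props(5)[OF v] sa(2) p by auto
    then show "diagram Z s (break_at p ?\<mu>) t = diag (insert p B)"
      unfolding diag_def using strands_at_breakpoints by metis
  qed
  finally show ?thesis .
qed

lemma maslov_diag: "\<exists>c. \<forall>B. indep B \<longrightarrow> maslov Z (diag B) = c - of_nat (card B)"
proof (intro exI allI impI)
  fix B assume "indep B"
  note sa = strands_at[OF this]
  note m = movingD[OF sa(1)]
  show "maslov Z (diag B) = - local_mult h {p \<in> places Z. p \<in> K \<and> step_before p \<notin> K} - of_nat (card B)"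
    unfolding diag_def using maslov_diagram_breakpoints[OF m(1,3)] m sa(2) by simp
qed

text \<open>A coordinate for each basis element: as supports are disjoint, evaluation at
  \<open>term_of B\<close> reads off the coefficient of \<open>diag B\<close>.\<close>

definition term_of :: "point set \<Rightarrow> strands" where
  "term_of B = (SOME \<nu>. \<nu> \<in> Poly_Mapping.keys (diag B))"

lemma lookup_diag:
  assumes "indep B" "indep B'"
  shows "Poly_Mapping.lookup (diag B) (term_of B') = of_bool (B' = B)"
proof -
  have "Poly_Mapping.keys (diag B') \<noteq> {}" using diagrams_keys_nonempty[OF diag_in[OF assms(2)]] .
  then have \<nu>: "term_of B' \<in> Poly_Mapping.keys (diag B')" unfolding term_of_def by (simp add: some_in_eq)
  have nh: "no_horizontal (strands_at C)" if "indep C" for C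
    using movingD(1)[OF strands_at(1)[OF that]] unfolding viable_strands_def by blast
  have "term_of B' \<in> Poly_Mapping.keys (diag B) \<longleftrightarrow> B' = B"
  proof
    assume "term_of B' \<in> Poly_Mapping.keys (diag B)"
    then have "strands_at B = strands_at B'"
      using diagram_key(1)[OF nh[OF assms(1)]] diagram_key(1)[OF nh[OF assms(2)]] \<nu>
      unfolding diag_def by metis
    then show "B' = B" using strands_at(2) assms by metis
  qed (use \<nu> in simp)
  moreover have "Poly_Mapping.lookup (diag B) (term_of B') \<in> {0, 1}" by (cases "Poly_Mapping.lookup (diag B) (term_of B')") auto
  ultimately show ?thesis by (auto simp: in_keys_iff)
qed

end

section \<open>From removal of an isolated place to the creation operator\<close>

text \<open>The multiplicity before the occupied place is nonzero and before its partner zero, so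
  the two cannot be exchanged. This makes the place selected in \<open>create_diagram\<close> well
  defined.\<close>

lemma once_occupied_11_at_unique:
  assumes "once_occupied_11_at Z H P p" "once_occupied_11_at Z H P p'"
  shows "p = p'"
proof -
  obtain h s t where H: "H = (h, s, t)" by (metis prod_cases3)
  obtain q where q: "pair_places Z P = {p, q}" "Poly_Mapping.lookup h (step_before q) = 0"
    using assms(1) unfolding once_occupied_11_at_def H by auto
  obtain q' where q': "pair_places Z P = {p', q'}" "Poly_Mapping.lookup h (step_before p') \<noteq> 0"
    using assms(2) unfolding once_occupied_11_at_def H by auto
  have "p' \<in> {p, q}" using q(1) q'(1) by blast
  then show ?thesis using q(2) q'(2) by auto
qed

context viable_hdata
begin

lemma contraction_removes:
  assumes fD: "\<And>B. indep B \<Longrightarrow> f (diag B) = 0 \<or> f (diag B) \<in> diagrams Z (h, s, t)"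
    and deg: "\<And>B. indep B \<Longrightarrow> f (diag B) \<noteq> 0 \<Longrightarrow> maslov Z (f (diag B)) = maslov Z (diag B) + d"
    and lin: "\<And>A F. finite A \<Longrightarrow> (\<And>a :: point. a \<in> A \<Longrightarrow> indep (F a)) \<Longrightarrow>
      f (\<Sum>a \<in> A. diag (F a)) = (\<Sum>a \<in> A. f (diag (F a)))"
    and hom: "\<And>B. indep B \<Longrightarrow> f (boundary (diag B)) + boundary (f (diag B)) = diag B"
  shows "\<exists>p. isolated p \<and> (\<forall>B. indep B \<longrightarrow> f (diag B) = (if p \<in> B then diag (B - {p}) else 0))"
proof -
  define g where "g B = (if f (diag B) = 0 then None else Some (SOME E. indep E \<and> f (diag B) = diag E))" for B
  have nz: "diag E \<noteq> 0" if "indep E" for E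
    using diag_in[OF that] unfolding diagrams_def by auto
  have gN: "f (diag B) = 0" if "g B = None" for B
    using that unfolding g_def by (auto split: if_splits)
  have gS: "indep E \<and> f (diag B) = diag E" if B: "indep B" and E: "g B = Some E" for B E
  proof -
    have ne: "f (diag B) \<noteq> 0" using E unfolding g_def by (auto split: if_splits)
    then have "\<exists>E. indep E \<and> f (diag B) = diag E" using fD[OF B] unfolding diagrams_eq_diag by blast
    then have "indep (SOME E. indep E \<and> f (diag B) = diag E) \<and>
        f (diag B) = diag (SOME E. indep E \<and> f (diag B) = diag E)" by (rule someI_ex)
    then show ?thesis using E ne unfolding g_def by simp
  qed
  have coef: "Poly_Mapping.lookup (f (diag B)) (term_of B') = of_bool (g B = Some B')"
    if B: "indep B" "indep B'" for B B'
  proof (cases "g B")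
    case None
    with gN show ?thesis by simp
  next
    case (Some E)
    with gS[OF B(1) Some] lookup_diag[OF _ B(2), of E] show ?thesis by auto
  qed
  obtain c where c: "\<And>B. indep B \<Longrightarrow> maslov Z (diag B) = c - of_nat (card B)"
    using maslov_diag by blast
  \<comment> \<open>\<open>d\<close> is rational; a nonzero \<open>f (diag B)\<close> forces it to
    be an integer, and the floor supplies an integer in every case. Its sign is reversed in
    \<open>g_card\<close> because the grading falls as breakpoints are added.\<close>
  interpret simple_contraction M "pair_of Z" g "\<lfloor>d\<rfloor>"
  proof
    fix B E assume B: "indep B" and E: "g B = Some E"
    note E' = gS[OF B E]
    show "indep E" using E' by blast
    have "c - of_nat (card E) = c - of_nat (card B) + d"
      using deg[OF B] E' nz[of E] c[of E] c[OF B] by simp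
    then have "d = of_int (int (card B) - int (card E))" by simp
    then have "\<lfloor>d\<rfloor> = int (card B) - int (card E)" by (metis floor_of_int)
    then show "int (card E) = int (card B) - \<lfloor>d\<rfloor>" by simp
  next
    fix B B' assume B: "indep B" and B': "indep B'"
    let ?c = "\<lambda>x. Poly_Mapping.lookup x (term_of B')"
    have "of_bool (B' = B) = ?c (diag B)" using lookup_diag[OF B B'] by simp
    also have "\<dots> = ?c (f (boundary (diag B))) + ?c (boundary (f (diag B)))"
      by (subst hom[OF B, symmetric]) (rule lookup_add)
    also have "?c (f (boundary (diag B))) = (\<Sum>p \<in> ext B. of_bool (g (insert p B) = Some B'))"
    proof -
      have "f (boundary (diag B)) = (\<Sum>p \<in> ext B. f (diag (insert p B)))"
        unfolding boundary_diag[OF B] using indep_insert[OF B] by (intro lin finite_ext)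
      then show ?thesis using coef[OF indep_insert[OF B] B'] by (simp add: lookup_sum)
    qed
    also have "?c (boundary (f (diag B))) =
        of_bool (\<exists>E. g B = Some E \<and> (\<exists>p \<in> ext E. B' = insert p E))"
    proof (cases "g B")
      case None
      with gN show ?thesis by (simp add: boundary_def)
    next
      case (Some E)
      note E = gS[OF B Some]
      have "?c (boundary (f (diag B))) = (\<Sum>p \<in> ext E. ?c (diag (insert p E)))"
        using E boundary_diag[of E] by (simp add: lookup_sum)
      also have "\<dots> = (\<Sum>p \<in> ext E. of_bool (B' = insert p E))"
        using E lookup_diag[OF indep_insert B'] by (intro sum.cong) auto
      \<comment> \<open>Distinct \<open>p\<close> outside \<open>E\<close> give distinct sets, so at
        most one summand is nonzero and the sum agrees with the truth value.\<close>
      also have "\<dots> = of_bool (\<exists>p \<in> ext E. B' = insert p E)"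
      proof (cases "\<exists>p \<in> ext E. B' = insert p E")
        case True
        then obtain p where p: "p \<in> ext E" "B' = insert p E" by blast
        have "(\<Sum>p \<in> ext E. of_bool (B' = insert p E)) = (1 :: bit)"
        proof (rule sum_of_bool_unique[of _ p])
          fix q assume "q \<in> ext E" "B' = insert q E"
          then show "q = p" using p ext_notin by (metis insert_iff)
        qed (use p finite_ext in auto)
        with True show ?thesis by simp
      next
        case False
        then show ?thesis by (subst sum_of_bool_none) auto
      qed
      finally show ?thesis using Some by simp
    qed
    finally show "of_bool (B' = B) = (\<Sum>p \<in> ext B. of_bool (g (insert p B) = Some B')) +
        (of_bool (\<exists>E. g B = Some E \<and> (\<exists>p \<in> ext E. B' = insert p E)) :: bit)" .
  qed
  obtain p where p: "isolated p"
    "\<And>B. indep B \<Longrightarrow> g B = (if p \<in> B then Some (B - {p}) else None)"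
    using contraction_is_removal by metis
  have "f (diag B) = (if p \<in> B then diag (B - {p}) else 0)" if B: "indep B" for B
    using p(2)[OF B] gS[OF B] gN[of B] by auto
  with p(1) show ?thesis by blast
qed

text \<open>If exactly one step at \<open>q\<close> were in the support, a moving strand would begin
  or end at \<open>q\<close> even in the diagram whose only breakpoint is \<open>p\<close>, and both
  places of the pair would be initial, or both final. If both steps were, the breakpoint could be
  moved from \<open>p\<close> to \<open>q\<close>, putting \<open>q\<close> into
  \<open>M\<close>.\<close>

lemma isolated_partner:
  assumes p: "isolated p"
    and q: "pair_places Z (pair_of Z p) = {p, q}" "q \<noteq> p" "q \<in> places Z" "pair_of Z q = pair_of Z p"
  shows "q \<notin> K" "step_before q \<notin> K"
proof -
  have pM: "p \<in> M" using p unfolding isolated_def by blast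
  obtain \<mu> where \<mu>: "\<mu> \<in> moving" "breakpoints \<mu> = {p}" using pM unfolding M_def by blast
  note v = movingD(1)[OF \<mu>(1)] and cov = movingD(4)[OF \<mu>(1)]
  note Mp = M_props[OF pM]
  have pb: "p \<in> breakpoints \<mu>" using \<mu>(2) by simp
  then have pp: "p \<in> Domain \<mu>" "p \<in> Range \<mu>" unfolding breakpoints_def by auto
  have qn: "q \<notin> Domain \<mu>" "q \<notin> Range \<mu>"
    using moving_pair_unique[OF \<mu>(1) Mp(1) q(3)] q(2,4) pp by auto
  have "\<not> (q \<in> K \<and> step_before q \<in> K)"
  proof
    assume qK: "q \<in> K \<and> step_before q \<in> K"
    let ?\<mu> = "join_at p \<mu>"
    note j = join_at_props[OF v pb] and jm = join_moving[OF \<mu>(1) pb]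
    have bj: "breakpoints ?\<mu> = {}" using j(5) \<mu>(2) by simp
    then have qp: "q \<in> passed ?\<mu>"
      using passed_iff[OF j(1), of q] qK j(2) cov place_nonzero[OF q(3)] by auto
    have "break_at q ?\<mu> \<in> moving"
    proof (rule break_moving[OF jm qp])
      show "pair_of Z q \<in> s" using Mp(4) q(4) by simp
      show "pair_places Z (pair_of Z q) = {q, p}" using q(1,4) by auto
      show "p \<noteq> q" using q(2) by simp
      show "p \<notin> Domain ?\<mu>" "p \<notin> Range ?\<mu>" unfolding j(3,4) by auto
    qed
    moreover have "breakpoints (break_at q ?\<mu>) = {q}" using break_at_props(5)[OF j(1) qp] bj by simp
    ultimately have "q \<in> M" unfolding M_def by blast
    then show False using p q(2,4) unfolding isolated_def by blast
  qed
  then show "q \<notin> K" "step_before q \<notin> K"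
    using qn Domain_iff_covered[OF v, of q] Range_iff_covered[OF v, of q] cov place_nonzero[OF q(3)] by auto
qed

lemma isolated_once_occupied:
  assumes p: "isolated p"
  shows "once_occupied_11_at Z (h, s, t) (pair_of Z p) p"
proof -
  have "p \<in> M" using p unfolding isolated_def by blast
  note Mp = M_props[OF this]
  obtain q where q: "pair_places Z (pair_of Z p) = {p, q}" "q \<noteq> p" "q \<in> places Z" "pair_of Z q = pair_of Z p"
    using pair_places_partner[OF arc Mp(1)] .
  have "Poly_Mapping.lookup h p \<noteq> 0" "Poly_Mapping.lookup h (step_before p) \<noteq> 0"
    "Poly_Mapping.lookup h q = 0" "Poly_Mapping.lookup h (step_before q) = 0"
    using Mp(2,3) isolated_partner[OF p q] unfolding K_def by simp_all
  then show ?thesis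
    unfolding once_occupied_11_at_def step_after_def prod.case
    by (intro conjI exI[of _ q] Mp(4,5) q(1) q(2)[symmetric])
qed

lemma moving_strands_diag:
  assumes "indep B"
  shows "moving_strands (diag B) = strands_at B"
proof -
  have "no_horizontal (strands_at B)"
    using movingD(1)[OF strands_at(1)[OF assms]] unfolding viable_strands_def by blast
  then have eq: "\<nu> - Id = strands_at B" if "\<nu> \<in> Poly_Mapping.keys (diag B)" for \<nu>
    using diagram_key(1) that unfolding diag_def by blast
  have "Poly_Mapping.keys (diag B) \<noteq> {}" using diagrams_keys_nonempty[OF diag_in[OF assms]] .
  then have "(\<Union>\<nu> \<in> Poly_Mapping.keys (diag B). \<nu> - Id) = strands_at B" using eq by auto
  then show ?thesis unfolding moving_strands_def by auto
qed

text \<open>Crossings lie at passed places. The support avoids \<open>q\<close>, while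
  \<open>p\<close> is passed exactly when it is not a breakpoint.\<close>

lemma crossing_at_isolated:
  assumes p: "isolated p" and B: "indep B"
  shows "crossing_at Z (pair_of Z p) (diag B) \<longleftrightarrow> p \<notin> B"
proof -
  let ?\<mu> = "strands_at B"
  note sa = strands_at[OF B]
  note v = movingD(1)[OF sa(1)] and cov = movingD(4)[OF sa(1)]
  have pM: "p \<in> M" using p unfolding isolated_def by blast
  note Mp = M_props[OF pM]
  obtain q where q: "pair_places Z (pair_of Z p) = {p, q}" "q \<noteq> p" "q \<in> places Z" "pair_of Z q = pair_of Z p"
    using pair_places_partner[OF arc Mp(1)] .
  have keys: "Poly_Mapping.keys (diag B) = (\<lambda>U. ?\<mu> \<union> Id_on U) ` horizontals Z s ?\<mu> t"
    unfolding diag_def by (rule keys_diagram)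
  show ?thesis
  proof
    assume "crossing_at Z (pair_of Z p) (diag B)"
    then obtain U \<sigma> \<tau> x where U: "(\<sigma>, \<tau>) \<in> crossings (?\<mu> \<union> Id_on U)"
      "x \<in> {p, q}" "\<sigma> = (x, x) \<or> \<tau> = (x, x)"
      unfolding crossing_at_def keys q(1) by blast
    then obtain u where u: "\<tau> = (u, u)" "\<sigma> \<in> ?\<mu>" "passes \<sigma> u" unfolding crossings_viable[OF v] by blast
    have "\<sigma> \<noteq> (x, x)" using viable_strands_less[OF v, of x x] u(2) by auto
    with U(3) u(1) have "u = x" by simp
    with u have x: "x \<in> passed ?\<mu>" unfolding passed_def by blast
    then have "x \<noteq> q" using isolated_partner[OF p q] passed_iff[OF v, of x] cov by blast
    with U(2) have "x = p" by blast
    with x show "p \<notin> B" using passed_iff[OF v, of p] sa(2) by blast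
  next
    assume "p \<notin> B"
    have "p \<in> ext B"
    proof (rule ccontr)
      assume "p \<notin> ext B"
      then obtain b where "b \<in> B" "pair_of Z b = pair_of Z p" using pM unfolding ext_def by auto
      then show False using p \<open>p \<notin> B\<close> indep_subset[OF B] unfolding isolated_def by metis
    qed
    then have pas: "p \<in> passed ?\<mu>" using ext_passed[OF sa(1)] sa(2) by simp
    \<comment> \<open>A crossing at \<open>p\<close> also requires a term with a horizontal there,
      which exists because breaking at \<open>p\<close> gives a nonzero diagram.\<close>
    then have "break_at p ?\<mu> \<in> moving" using break_moving_ext[OF sa(1)] sa(2) \<open>p \<in> ext B\<close> by simp
    then obtain U where U: "U \<in> horizontals Z s ?\<mu> t" "p \<in> U" using break_moving_iff[OF sa(1) pas] by blast
    obtain \<sigma> where \<sigma>: "\<sigma> \<in> ?\<mu>" "passes \<sigma> p" using pas unfolding passed_def by blast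
    have "(\<sigma>, (p, p)) \<in> crossings (?\<mu> \<union> Id_on U)" unfolding crossings_viable[OF v] using \<sigma> U(2) by blast
    then show "crossing_at Z (pair_of Z p) (diag B)"
      unfolding crossing_at_def keys q(1) using U(1) by blast
  qed
qed

lemma create_diagram_diag:
  assumes p: "isolated p" and B: "indep B" and C: "C (h, s, t) = pair_of Z p"
  shows "create_diagram Z C (diag B) = (if p \<in> B then diag (B - {p}) else 0)"
proof -
  note sa = strands_at[OF B]
  have H: "hdata_of Z (diag B) = (h, s, t)" by (rule hdata_of_diagram[OF diag_in[OF B]])
  have the: "(THE x. once_occupied_11_at Z (h, s, t) (pair_of Z p) x) = p"
    using isolated_once_occupied[OF p] once_occupied_11_at_unique by blast
  have "diagram Z s (join_at p (strands_at B)) t = diag (B - {p})" if "p \<in> B"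
  proof -
    have pb: "p \<in> breakpoints (strands_at B)" using that sa(2) by simp
    have "breakpoints (join_at p (strands_at B)) = B - {p}"
      using join_at_props(5)[OF movingD(1)[OF sa(1)] pb] sa(2) by simp
    then have "join_at p (strands_at B) = strands_at (B - {p})"
      using strands_at_breakpoints[OF join_moving[OF sa(1) pb]] by simp
    then show ?thesis unfolding diag_def by simp
  qed
  then show ?thesis
    unfolding create_diagram_def Let_def H C the crossing_at_isolated[OF p B] moving_strands_diag[OF B]
    by simp
qed

end

section \<open>Assembling the summands\<close>

lemma twisted_viable_hdata:
  assumes "is_arc_diagram Z" "(h, s, t) \<in> twisted_hdata Z"
  shows "viable_hdata Z h s t"
proof
  obtain D where D: "D \<in> diagrams Z (h, s, t)" using assms(2) unfolding twisted_hdata_def by blast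
  then show "is_hdata Z (h, s, t)" "diagrams Z (h, s, t) \<noteq> {}" unfolding diagrams_def by auto
  show "viable Z h" using assms(2) unfolding twisted_hdata_def by simp
qed (rule assms(1))

lemma diagrams_twisted_subset: "diagrams_twisted_hdata Z \<subseteq> all_diagrams Z"
  unfolding diagrams_twisted_hdata_def all_diagrams_def by blast

lemma twisted_sum_eq: "twisted_sum Z = chain.span (diagrams_twisted_hdata Z)"
proof
  have "hdata_summand Z H \<subseteq> chain.span (diagrams_twisted_hdata Z)" if "H \<in> twisted_hdata Z" for H
    unfolding hdata_summand_def diagrams_twisted_hdata_def using that by (intro chain.span_mono) blast
  then show "twisted_sum Z \<subseteq> chain.span (diagrams_twisted_hdata Z)"
    unfolding twisted_sum_def by (intro chain.span_minimal chain.subspace_span) blast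
  have "diagrams_twisted_hdata Z \<subseteq> (\<Union>H \<in> twisted_hdata Z. hdata_summand Z H)"
    unfolding diagrams_twisted_hdata_def hdata_summand_def using chain.span_superset by blast
  then show "chain.span (diagrams_twisted_hdata Z) \<subseteq> twisted_sum Z"
    unfolding twisted_sum_def by (rule chain.span_mono)
qed

lemma linear_on_subspace_sum:
  assumes "linear_on_subspace (chain.span S) f" "finite A" "\<And>a. a \<in> A \<Longrightarrow> x a \<in> chain.span S"
  shows "f (\<Sum>a \<in> A. x a) = (\<Sum>a \<in> A. f (x a))"
  using assms(2,3)
proof (induction A)
  case empty
  have "f (scale_chain 0 0) = scale_chain 0 (f 0)"
    using assms(1) chain.span_zero unfolding linear_on_subspace_def by blast
  then show ?case by simp
next
  case (insert a A)
  then have "x a \<in> chain.span S" "(\<Sum>a \<in> A. x a) \<in> chain.span S" by (auto intro: chain.span_sum)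
  then have "f (x a + (\<Sum>a \<in> A. x a)) = f (x a) + f (\<Sum>a \<in> A. x a)"
    using assms(1) unfolding linear_on_subspace_def by blast
  with insert show ?case by simp
qed

text \<open>The conclusion ranges over all \<open>C\<close> with the right value at
  \<open>H\<close>, since \<open>create_diagram\<close> consults \<open>C\<close> only there. So a
  place can be found for each \<open>H\<close> separately before the choice function is put
  together.\<close>

lemma contraction_removes_in_twisted:
  assumes arc: "is_arc_diagram Z" and H: "H \<in> twisted_hdata Z"
    and lin: "linear_on_subspace (twisted_sum Z) f"
    and simple: "diagrammatically_simple Z f"
    and pres: "preserves_hdata Z f"
    and deg: "pure_maslov_degree Z f"
    and hom: "\<forall>x \<in> twisted_sum Z. f (boundary x) + boundary (f x) = x"
  shows "\<exists>p \<in> places Z. once_occupied_11_at Z H (pair_of Z p) p \<and>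
    (\<forall>C. \<forall>D \<in> diagrams Z H. C H = pair_of Z p \<longrightarrow> f D = create_diagram Z C D)"
proof -
  obtain h s t where Heq: "H = (h, s, t)" by (metis prod_cases3)
  interpret viable_hdata Z h s t using twisted_viable_hdata[OF arc] H Heq by simp
  let ?S = "diagrams_twisted_hdata Z"
  have DS: "diagrams Z (h, s, t) \<subseteq> ?S" using H Heq unfolding diagrams_twisted_hdata_def by blast
  obtain d where d: "\<And>m. f ` chain.span {D \<in> ?S. maslov Z D = m} \<subseteq> chain.span {D \<in> ?S. maslov Z D = m + d}"
    using deg unfolding pure_maslov_degree_def by blast
  have in_V: "D \<in> twisted_sum Z" if "D \<in> ?S" for D
    using that chain.span_base unfolding twisted_sum_eq by blast
  have fD: "f D = 0 \<or> f D \<in> diagrams Z (h, s, t)" if D: "D \<in> diagrams Z (h, s, t)" for D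
  proof (cases "f D = 0")
    case False
    then obtain H' where H': "f D \<in> diagrams Z H'"
      using simple D DS unfolding diagrammatically_simple_def all_diagrams_def by blast
    have "D \<in> hdata_summand Z H" unfolding hdata_summand_def Heq using chain.span_base[OF D] .
    \<comment> \<open>Preservation of H-data only puts \<open>f D\<close> into a span; as
      \<open>f D\<close> is itself a diagram, it is then one of the generators. The Maslov degree is
      extracted from its span in the same way below.\<close>
    then have "f D \<in> chain.span (diagrams Z (h, s, t))"
      using pres H Heq unfolding preserves_hdata_def hdata_summand_def by blast
    then have "f D \<in> diagrams Z (h, s, t)"
      by (rule diagram_in_span[OF H']) (use DS diagrams_twisted_subset in blast)
    then show ?thesis ..
  qed simp
  have "\<exists>p. isolated p \<and> (\<forall>B. indep B \<longrightarrow> f (diag B) = (if p \<in> B then diag (B - {p}) else 0))"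
  proof (rule contraction_removes)
    fix B assume B: "indep B"
    show "f (diag B) = 0 \<or> f (diag B) \<in> diagrams Z (h, s, t)" using fD diag_in[OF B] by blast
    have "diag B \<in> ?S" using diag_in[OF B] DS by blast
    then show "f (boundary (diag B)) + boundary (f (diag B)) = diag B" using hom in_V by blast
    assume "f (diag B) \<noteq> 0"
    then have fd: "f (diag B) \<in> diagrams Z (h, s, t)" using fD diag_in[OF B] by blast
    have "diag B \<in> chain.span {D \<in> ?S. maslov Z D = maslov Z (diag B)}"
      using \<open>diag B \<in> ?S\<close> by (intro chain.span_base) simp
    then have "f (diag B) \<in> chain.span {D \<in> ?S. maslov Z D = maslov Z (diag B) + d}" using d by blast
    then have "f (diag B) \<in> {D \<in> ?S. maslov Z D = maslov Z (diag B) + d}"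
      by (rule diagram_in_span[OF fd]) (use diagrams_twisted_subset in blast)
    then show "maslov Z (f (diag B)) = maslov Z (diag B) + d" by simp
  next
    fix A :: "point set" and F assume "finite A" "\<And>a. a \<in> A \<Longrightarrow> indep (F a)"
    then show "f (\<Sum>a \<in> A. diag (F a)) = (\<Sum>a \<in> A. f (diag (F a)))"
      using lin DS diag_in unfolding twisted_sum_eq
      by (intro linear_on_subspace_sum) (auto intro!: chain.span_base)
  qed
  then obtain p where p: "isolated p"
    "\<And>B. indep B \<Longrightarrow> f (diag B) = (if p \<in> B then diag (B - {p}) else 0)" by blast
  have "f D = create_diagram Z C D" if "D \<in> diagrams Z H" "C H = pair_of Z p" for C D
  proof -
    obtain B where B: "indep B" "D = diag B"
      using \<open>D \<in> diagrams Z H\<close> unfolding Heq diagrams_eq_diag by blast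
    show ?thesis using p(2)[OF B(1)] create_diagram_diag[OF p(1) B(1)] \<open>C H = pair_of Z p\<close> Heq B(2) by simp
  qed
  moreover have "p \<in> places Z" using p(1) M_props(1) unfolding isolated_def by blast
  ultimately show ?thesis using isolated_once_occupied[OF p(1)] Heq by blast
qed

theorem proposition3p18:
  fixes Z :: arc_diagram
    and f :: "chain \<Rightarrow> chain"
  assumes "is_arc_diagram Z"
    and "f ` twisted_sum Z \<subseteq> twisted_sum Z"
    and "linear_on_subspace (twisted_sum Z) f"
    and "diagrammatically_simple Z f"
    and "preserves_hdata Z f"
    and "pure_maslov_degree Z f"
    and "\<forall>x \<in> twisted_sum Z. f (boundary x) + boundary (f x) = x"
  shows "\<exists>C. creation_choice Z C \<and> (\<forall>x \<in> twisted_sum Z. f x = creation_operator Z C x)"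
proof -
  let ?S = "diagrams_twisted_hdata Z"
  have "\<forall>H \<in> twisted_hdata Z. \<exists>p \<in> places Z. once_occupied_11_at Z H (pair_of Z p) p \<and>
      (\<forall>C. \<forall>D \<in> diagrams Z H. C H = pair_of Z p \<longrightarrow> f D = create_diagram Z C D)"
    using contraction_removes_in_twisted assms by blast
  then obtain p where p: "\<And>H. H \<in> twisted_hdata Z \<Longrightarrow> p H \<in> places Z"
    "\<And>H. H \<in> twisted_hdata Z \<Longrightarrow> once_occupied_11_at Z H (pair_of Z (p H)) (p H)"
    "\<And>H C D. H \<in> twisted_hdata Z \<Longrightarrow> D \<in> diagrams Z H \<Longrightarrow> C H = pair_of Z (p H) \<Longrightarrow>
      f D = create_diagram Z C D"
    by metis
  define C where "C H = pair_of Z (p H)" for H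
  have choice: "creation_choice Z C"
    unfolding creation_choice_def C_def using p(1,2) assms(1) unfolding is_arc_diagram_def by blast
  have fD: "f D = create_diagram Z C D" if "D \<in> ?S" for D
    using that p(3)[of _ D C] unfolding diagrams_twisted_hdata_def C_def by blast
  have lin: "linear_on_subspace (chain.span ?S) f" using assms(3) unfolding twisted_sum_eq .
  have ind: "chain.independent ?S"
    using chain.independent_mono[OF independent_diagrams diagrams_twisted_subset] .
  have "f x = creation_operator Z C x" if x: "x \<in> chain.span ?S" for x
  proof -
    let ?r = "chain.representation ?S x"
    let ?A = "{D. ?r D \<noteq> 0}"
    have fin: "finite ?A" by (rule chain.finite_representation)
    have AS: "D \<in> ?S" if "D \<in> ?A" for D using that chain.representation_ne_zero by simp
    \<comment> \<open>Linearity expands \<open>f\<close> over the same basis of diagrams through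
      which \<open>creation_operator\<close> is defined.\<close>
    have "f x = f (\<Sum>D \<in> ?A. scale_chain (?r D) D)"
      using chain.sum_nonzero_representation_eq[OF ind x] by simp
    also have "\<dots> = (\<Sum>D \<in> ?A. f (scale_chain (?r D) D))"
      using AS by (intro linear_on_subspace_sum[OF lin fin] chain.span_scale chain.span_base)
    also have "\<dots> = (\<Sum>D \<in> ?A. scale_chain (?r D) (create_diagram Z C D))"
    proof (rule sum.cong[OF refl])
      fix D assume "D \<in> ?A"
      then have D: "D \<in> ?S" by (rule AS)
      then show "f (scale_chain (?r D) D) = scale_chain (?r D) (create_diagram Z C D)"
        using lin chain.span_base[OF D] fD[OF D] unfolding linear_on_subspace_def by simp
    qed
    finally show ?thesis unfolding creation_operator_def .
  qed
  with choice show ?thesis unfolding twisted_sum_eq by blast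
qed

end
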